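(* Let $n\ge 1$, $L>0$, and let $M\in\mathbb{R}^{n\times n}$ be diagonalizable with distinct, strictly positive real eigenvalues $\lambda_1>\dots>\lambda_n>0$. Let $T\in\mathbb{R}^{n\times n}$ be invertible with $T^{-1}MT=\Lambda:=\mathrm{diag}(\lambda_1,\dots,\lambda_n)$. Let $\mathcal{A},\mathcal{K}^0,\mathcal{K}^L\in\mathbb{R}^{n\times n}$ be such that $\mathcal{A}-\mathcal{K}^0$ is invertible and $\mathcal{K}^L=uv^T$ is of rank one, with nonzero column vectors $u,v\in\mathbb{R}^n$. Then the system $$\partial_t R(t,x)+\Lambda\,\partial_x R(t,x)=0,\quad t>0,\ x\in[0,L],\qquad R(0,x)=R_0(x),\quad x\in[0,L],$$ with boundary conditions $$R(t,0)=\big((\mathcal{A}-\mathcal{K}^0)T\big)^{-1}\mathcal{K}^L T\,R(t,L)$$ is robustly exponentially stable if and only if $$|v^TT|\cdot\big|\big((\mathcal{A}-\mathcal{K}^0)T\big)^{-1}u\big|<1,$$ where $|\cdot|$ denotes the entrywise absolute value of a vector and $\cdot$ is the product of the row vector $|v^TT|$ with the column vector $|((\mathcal{A}-\mathcal{K}^0)T)^{-1}u|$, that is, the condition reads $\sum_{j=1}^n |(v^TT)_j|\,\big|\big(((\mathcal{A}-\mathcal{K}^0)T)^{-1}u\big)_j\big|<1$.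
   Context: Origin of the setting: $R=T^{-1}Y$ are the Riemann coordinates of the physical variables $Y$ solving $\partial_tY+M\partial_xY=0$ with boundary conditions $(\mathcal{A}-\mathcal{K}^0)Y(t,0)=\mathcal{K}^LY(t,L)$. Here $\mathcal{A}$ represents physical boundary constraints, and $\mathcal{K}^0,\mathcal{K}^L$ are control matrices whose columns corresponding to unobserved variables (possibly none) are zero. Notation: write $K:=((\mathcal{A}-\mathcal{K}^0)T)^{-1}\mathcal{K}^LT$, so the boundary condition is $R(t,0)=KR(t,L)$. $L^2$-solution: for $R_0\in L^2((0,L);\mathbb{R}^n)$ and a diagonal matrix $\Lambda$ with positive diagonal entries, the $L^2$-solution is the (unique, existing) map $R\in C^0([0,+\infty);L^2((0,L);\mathbb{R}^n))$ with $R(0,\cdot)=R_0$ such that for every $\tau>0$ and every $\varphi\in C^1([0,\tau]\times[0,L];\mathbb{R}^n)$ with $\Lambda\varphi(t,L)=K^T\Lambda\varphi(t,0)$ for all $t\in[0,\tau]$, $$\int_0^L\varphi(\tau,x)^TR(\tau,x)\,dx-\int_0^L\varphi(0,x)^TR_0(x)\,dx=\int_0^\tau\!\!\int_0^L(\partial_t\varphi+\Lambda\partial_x\varphi)^TR\,dx\,dt.$$ Exponential stability (in the $L^2$ norm): there exist $\nu>0$ and $C>0$ such that for every $R_0\in L^2((0,L);\mathbb{R}^n)$ the $L^2$-solution satisfies $\|R(t,\cdot)\|_{L^2((0,L);\mathbb{R}^n)}\le C\exp(-\nu t)\|R_0\|_{L^2((0,L);\mathbb{R}^n)}$ for all $t\in[0,+\infty)$.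 Robust exponential stability: there exists $\varepsilon>0$ such that the perturbed system $\partial_tR+\tilde\Lambda\partial_xR=0$, with the same boundary condition $R(t,0)=KR(t,L)$, is exponentially stable for every diagonal matrix $\tilde\Lambda=\mathrm{diag}(\tilde\lambda_1,\dots,\tilde\lambda_n)$ with $|\tilde\lambda_i-\lambda_i|\le\varepsilon$ for all $i\in\{1,\dots,n\}$. *)

theory Defs
  imports "HOL-Analysis.Analysis"
begin

definition diag :: "real^'n \<Rightarrow> real^'n^'n" where
  "diag d = (\<chi> i j. if i = j then d $ i else 0)"

text \<open>
  Elements of \<open>L\<^sup>2((0,L);\<real>\<^sup>n)\<close> are represented by functions; equality of classes is
  equality almost everywhere on \<open>(0,L)\<close>.
\<close>

definition L2 :: "real \<Rightarrow> (real \<Rightarrow> real^'n) set" where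
  "L2 L = {f. f \<in> borel_measurable (lebesgue_on {0<..<L}) \<and>
              integrable (lebesgue_on {0<..<L}) (\<lambda>x. (norm (f x))\<^sup>2)}"

definition L2_norm :: "real \<Rightarrow> (real \<Rightarrow> real^'n) \<Rightarrow> real" where
  "L2_norm L f = sqrt (LINT x|lebesgue_on {0<..<L}. (norm (f x))\<^sup>2)"

definition C0_L2 :: "real \<Rightarrow> (real \<Rightarrow> real \<Rightarrow> real^'n) \<Rightarrow> bool" where
  "C0_L2 L R \<longleftrightarrow>
     (\<forall>t\<ge>0. R t \<in> L2 L) \<and>
     (\<forall>t\<ge>0. ((\<lambda>s. L2_norm L (\<lambda>x. R s x - R t x)) \<longlongrightarrow> 0) (at t within {0..}))"

text \<open>
  \<open>\<phi>\<close> is of class \<open>C\<^sup>1\<close> on the closed rectangle \<open>[0,\<tau>] \<times> [0,L]\<close>, with partial derivatives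
  \<open>\<phi>t\<close> and \<open>\<phi>x\<close> (one-sided on the boundary).
\<close>

definition C1_rectangle ::
    "real \<Rightarrow> real \<Rightarrow> (real \<Rightarrow> real \<Rightarrow> real^'n) \<Rightarrow> (real \<Rightarrow> real \<Rightarrow> real^'n) \<Rightarrow>
     (real \<Rightarrow> real \<Rightarrow> real^'n) \<Rightarrow> bool" where
  "C1_rectangle \<tau> L \<phi> \<phi>t \<phi>x \<longleftrightarrow>
     (\<forall>t\<in>{0..\<tau>}. \<forall>x\<in>{0..L}.
        ((\<lambda>s. \<phi> s x) has_vector_derivative \<phi>t t x) (at t within {0..\<tau>}) \<and>
        ((\<lambda>y. \<phi> t y) has_vector_derivative \<phi>x t x) (at x within {0..L})) \<and>
     continuous_on ({0..\<tau>} \<times> {0..L}) (\<lambda>(t, x). \<phi>t t x) \<and>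
     continuous_on ({0..\<tau>} \<times> {0..L}) (\<lambda>(t, x). \<phi>x t x)"

text \<open>
  \<open>R\<close> is an \<open>L\<^sup>2\<close>-solution of \<open>\<partial>\<^sub>t R + \<Lambda> \<partial>\<^sub>x R = 0\<close>, \<open>R(t,0) = K R(t,L)\<close>, \<open>R(0,\<cdot>) = R0\<close>.
  The condition on the test functions makes the boundary terms vanish when the equation is
  multiplied by \<open>\<phi>\<close> and integrated by parts.
\<close>

definition L2_solution ::
    "real \<Rightarrow> real^'n^'n \<Rightarrow> real^'n^'n \<Rightarrow> (real \<Rightarrow> real^'n) \<Rightarrow> (real \<Rightarrow> real \<Rightarrow> real^'n) \<Rightarrow> bool" where
  "L2_solution L \<Lambda> K R0 R \<longleftrightarrow>
     C0_L2 L R \<and>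
     (AE x in lebesgue_on {0<..<L}. R 0 x = R0 x) \<and>
     (\<forall>\<tau>>0. \<forall>\<phi> \<phi>t \<phi>x.
        C1_rectangle \<tau> L \<phi> \<phi>t \<phi>x \<and>
        (\<forall>t\<in>{0..\<tau>}. \<Lambda> *v \<phi> t L = transpose K *v (\<Lambda> *v \<phi> t 0)) \<longrightarrow>
        (LINT x|lebesgue_on {0<..<L}. \<phi> \<tau> x \<bullet> R \<tau> x)
          - (LINT x|lebesgue_on {0<..<L}. \<phi> 0 x \<bullet> R0 x)
        = (LINT t|lebesgue_on {0..\<tau>}. LINT x|lebesgue_on {0<..<L}.
             (\<phi>t t x + \<Lambda> *v \<phi>x t x) \<bullet> R t x))"

text \<open>
  For \<open>\<Lambda>\<close> diagonal with positive entries the solution exists and is unique as a map into the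
  space of classes, so the quantifier over \<open>R\<close> below ranges over the representatives of one
  single solution.
\<close>

definition exponentially_stable :: "real \<Rightarrow> real^'n^'n \<Rightarrow> real^'n^'n \<Rightarrow> bool" where
  "exponentially_stable L \<Lambda> K \<longleftrightarrow>
     (\<exists>\<nu>>0. \<exists>C>0. \<forall>R0\<in>L2 L. \<forall>R. L2_solution L \<Lambda> K R0 R \<longrightarrow>
        (\<forall>t\<ge>0. L2_norm L (R t) \<le> C * exp (- \<nu> * t) * L2_norm L R0))"

text \<open>
  If some \<open>\<epsilon>\<close> works below, so does every smaller positive one; hence for positive \<open>l\<close> it is
  irrelevant that a large \<open>\<epsilon>\<close> would also admit nonpositive perturbed speeds.
\<close>

definition robustly_exponentially_stable :: "real \<Rightarrow> real^'n \<Rightarrow> real^'n^'n \<Rightarrow> bool" where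
  "robustly_exponentially_stable L l K \<longleftrightarrow>
     (\<exists>\<epsilon>>0. \<forall>\<mu>. (\<forall>i. \<bar>\<mu> $ i - l $ i\<bar> \<le> \<epsilon>) \<longrightarrow> exponentially_stable L (diag \<mu>) K)"

end

theory Submission
  imports Defs
begin

text \<open>
  The boundary matrix has rank one, \<open>K = p q\<^sup>T\<close> with \<open>p = ((A - K0) T)\<^sup>-\<^sup>1 u\<close> and \<open>q = T\<^sup>T v\<close>, so the whole
  system is driven by the single scalar \<open>h(t) = q\<^sup>T R(t,L)\<close>. Along characteristics
  \<open>R\<^sub>j(t,x) = p\<^sub>j h(t - x/\<mu>\<^sub>j)\<close>, which turns the boundary condition into the delay equation
  \<open>h(t) = \<Sum>\<^sub>j c\<^sub>j h(t - L/\<mu>\<^sub>j)\<close> with \<open>c\<^sub>j = p\<^sub>j q\<^sub>j\<close>. The criterion is \<open>\<Sum>\<^sub>j \<bar>c\<^sub>j\<bar> < 1\<close>, the classical condition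
  for stability of this equation robustly with respect to the delays.

  If \<open>\<Sum>\<^sub>j \<bar>c\<^sub>j\<bar> < 1\<close>, every choice of positive speeds is stable. Since a solution is only given weakly,
  the estimate is made for the adjoint problem: for a \<open>C\<^sup>1\<close> profile \<open>\<psi>\<close> vanishing outside \<open>(0,L)\<close>, the
  adjoint problem has an explicit \<open>C\<^sup>1\<close> solution that equals \<open>\<psi>\<close> at time \<open>T\<close>, built from the same
  delay equation with a source term. Its decay follows from a weighted energy estimate based on
  Jensen's inequality (\<open>energy_delay_iter\<close>, \<open>adjoint_solution\<close>). Used as a test function, it bounds the
  pairing of \<open>R(T)\<close> with \<open>\<psi>\<close>, and a density argument (\<open>L2_bound_by_testing\<close>) gives the bound on the norm.

  If \<open>\<Sum>\<^sub>j \<bar>c\<^sub>j\<bar> \<ge> 1\<close>, speeds arbitrarily close to the given ones admit a frequency \<open>\<omega>\<close> at which the delay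
  \<open>L/\<mu>\<^sub>j\<close> turns \<open>cos(\<omega> t)\<close> into \<open>sgn(c\<^sub>j) cos(\<omega> t)\<close>. Then \<open>exp(a t) cos(\<omega> t)\<close> solves the delay equation for
  some \<open>a \<ge> 0\<close>, and the corresponding solution of the system does not decay
  (\<open>not_robustly_exponentially_stable\<close>).
\<close>

section \<open>Rank-one and diagonal matrices\<close>

lemma diag_mult_nth: "(diag d *v x) $ i = d $ i * x $ i"
  by (simp add: diag_def matrix_vector_mult_def if_distrib[of "\<lambda>z. z * _"] cong: if_cong)

text \<open>The rank-one matrix \<open>p q\<^sup>T\<close>.\<close>

definition outer :: "real^'n \<Rightarrow> real^'n \<Rightarrow> real^'n^'n" where
  "outer p q = (\<chi> i j. p $ i * q $ j)"

lemma outer_mult_nth: "(outer p q *v x) $ i = p $ i * (\<Sum>j\<in>UNIV. q $ j * x $ j)"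
  by (simp add: outer_def matrix_vector_mult_def sum_distrib_left mult_ac)

lemma transpose_outer: "transpose (outer p q) = outer q p"
  by (simp add: outer_def transpose_def mult.commute vec_eq_iff)

lemma inner_diag_commute: "(diag d *v x) \<bullet> y = x \<bullet> (diag d *v y)"
  by (simp add: inner_vec_def diag_mult_nth mult_ac)

lemma rank_one_conjugation:
  fixes B T :: "real^'n::finite^'n"
  shows "B ** ((columnvector u :: real^1^'n) ** (rowvector v :: real^'n^1)) ** T = outer (B *v u) (v v* T)"
  by (simp add: vec_eq_iff matrix_matrix_mult_def matrix_vector_mult_def vector_matrix_mult_def
      outer_def columnvector_def rowvector_def sum_distrib_left sum_distrib_right mult_ac)

section \<open>Derivatives and integrals on intervals\<close>

lemma has_vector_derivative_vecI:
  fixes f :: "real \<Rightarrow> real^'n"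
  assumes "\<And>j. ((\<lambda>s. f s $ j) has_real_derivative f' $ j) (at t within S)"
  shows "(f has_vector_derivative f') (at t within S)"
  unfolding has_vector_derivative_def
proof (subst has_derivative_componentwise_within, rule ballI)
  fix i :: "real^'n" assume "i \<in> Basis"
  then obtain j where i: "i = axis j 1" by (auto simp: Basis_vec_def)
  show "((\<lambda>x. f x \<bullet> i) has_derivative (\<lambda>h. (h *\<^sub>R f') \<bullet> i)) (at t within S)"
  proof -
    have "(*) (f' $ j) = (\<lambda>h. h * f' $ j)" by (simp add: fun_eq_iff)
    then show ?thesis
      using assms[of j] by (simp add: i inner_axis has_field_derivative_def)
  qed
qed

lemma integral_lebesgue_on_le_lborel:
  fixes f :: "real \<Rightarrow> real"
  assumes "integrable lborel f" "\<And>x. f x \<ge> 0" "S \<in> sets borel"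
  shows "integrable (lebesgue_on S) f" "(LINT x|lebesgue_on S. f x) \<le> (LINT x|lborel. f x)"
proof -
  have i: "integrable lebesgue f"
    using assms(1) by (simp add: integrable_completion borel_measurable_integrable)
  have iS: "integrable lebesgue (\<lambda>x. if x \<in> S then f x else 0)"
    by (rule Bochner_Integration.integrable_bound[OF i])
       (use assms i in \<open>auto intro!: borel_measurable_if_I measurable_restrict_space1\<close>)
  show "integrable (lebesgue_on S) f"
    using iS Lebesgue_Measure.integrable_restrict_UNIV[of S f] assms(3) by auto
  have "(LINT x|lebesgue_on S. f x) = (LINT x|lebesgue. (if x \<in> S then f x else 0))"
    using assms(3) by (intro Lebesgue_Measure.integral_restrict_UNIV[symmetric]) auto
  also have "\<dots> \<le> (LINT x|lebesgue. f x)"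
    using iS i assms(2) by (intro integral_mono) auto
  also have "\<dots> = (LINT x|lborel. f x)"
    using assms(1) by (simp add: integral_completion borel_measurable_integrable)
  finally show "(LINT x|lebesgue_on S. f x) \<le> (LINT x|lborel. f x)" .
qed

lemma integral_lebesgue_on_eq_lborel:
  fixes f :: "real \<Rightarrow> real"
  assumes "f \<in> borel_measurable borel" "\<And>x. x \<notin> S \<Longrightarrow> f x = 0" "S \<in> sets borel"
  shows "(LINT x|lebesgue_on S. f x) = (LINT x|lborel. f x)"
proof -
  have "(LINT x|lebesgue_on S. f x) = (LINT x|lebesgue. (if x \<in> S then f x else 0))"
    using assms(3) by (intro Lebesgue_Measure.integral_restrict_UNIV[symmetric]) auto
  also have "\<dots> = (LINT x|lebesgue. f x)"
    using assms(2) by (intro Bochner_Integration.integral_cong) auto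
  also have "\<dots> = (LINT x|lborel. f x)"
    using assms(1) by (simp add: integral_completion)
  finally show ?thesis .
qed

lemma integrable_lborel_zero_outside:
  fixes f :: "real \<Rightarrow> real"
  assumes "continuous_on UNIV f" "\<And>x. x \<notin> {a..b} \<Longrightarrow> f x = 0"
  shows "integrable lborel f"
proof -
  have "set_integrable lborel {a..b} f"
    using assms(1) by (intro borel_integrable_atLeastAtMost') (rule continuous_on_subset, auto)
  moreover have "(\<lambda>x. indicator {a..b} x *\<^sub>R f x) = f"
    using assms(2) by (auto simp: indicator_def fun_eq_iff)
  ultimately show ?thesis by (simp add: set_integrable_def)
qed

lemma integral_open_interval_continuous:
  fixes f :: "real \<Rightarrow> real"
  assumes "continuous_on {0..L} f"
  shows "integrable (lebesgue_on {0<..<L}) f"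
    and "(LINT x|lebesgue_on {0<..<L}. f x) = integral {0..L} f"
proof -
  have "integrable (lebesgue_on {0..L}) f"
    by (rule continuous_imp_integrable_real[OF assms])
  then have "set_integrable lebesgue {0..L} f"
    by (simp add: set_integrable_def integrable_restrict_space)
  then have "set_integrable lebesgue {0<..<L} f"
    by (rule set_integrable_subset) auto
  then show i: "integrable (lebesgue_on {0<..<L}) f"
    by (simp add: set_integrable_def integrable_restrict_space)
  show "(LINT x|lebesgue_on {0<..<L}. f x) = integral {0..L} f"
    using lebesgue_integral_eq_integral[OF i] integral_open_interval_real[of 0 L f] by simp
qed

lemma L2_continuous:
  assumes "continuous_on {0..L} f"
  shows "f \<in> L2 L"
proof -
  have "f \<in> borel_measurable (lebesgue_on {0<..<L})"
    by (intro continuous_imp_measurable_on_sets_lebesgue continuous_on_subset[OF assms]) auto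
  moreover have "integrable (lebesgue_on {0<..<L}) (\<lambda>x. (norm (f x))\<^sup>2)"
    by (intro integral_open_interval_continuous(1) continuous_intros assms)
  ultimately show ?thesis by (simp add: L2_def)
qed

text \<open>Continuously differentiable functions on the whole line.\<close>

definition C1_line :: "(real \<Rightarrow> real) \<Rightarrow> bool" where
  "C1_line f \<longleftrightarrow>
     (\<exists>f'. continuous_on UNIV f' \<and> (\<forall>x. (f has_real_derivative f' x) (at x)))"

lemma C1_line_continuous: "C1_line f \<Longrightarrow> continuous_on S f"
  unfolding C1_line_def
  by (meson DERIV_isCont continuous_at_imp_continuous_on)

lemma C1_line_const: "C1_line (\<lambda>x. a)"
  unfolding C1_line_def by (rule exI[of _ "\<lambda>x. 0"]) auto

lemma C1_line_add: "C1_line f \<Longrightarrow> C1_line g \<Longrightarrow> C1_line (\<lambda>x. f x + g x)"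
  unfolding C1_line_def by (blast intro: DERIV_add continuous_on_add)

lemma C1_line_cmult: "C1_line f \<Longrightarrow> C1_line (\<lambda>x. a * f x)"
  unfolding C1_line_def by (blast intro: DERIV_cmult continuous_on_mult_left)

lemma C1_line_sum:
  "finite A \<Longrightarrow> (\<And>k. k \<in> A \<Longrightarrow> C1_line (f k)) \<Longrightarrow> C1_line (\<lambda>x. \<Sum>k\<in>A. f k x)"
  by (induction A rule: finite_induct) (auto intro: C1_line_const C1_line_add)

lemma C1_line_affine:
  assumes "C1_line f" shows "C1_line (\<lambda>x. f (a * x + b))"
proof -
  obtain f' where f': "continuous_on UNIV f'" "\<And>x. (f has_real_derivative f' x) (at x)"
    using assms unfolding C1_line_def by blast
  have "((\<lambda>x. f (a * x + b)) has_real_derivative f' (a * x + b) * a) (at x)" for x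
    by (rule DERIV_chain2[where f = f and g = "\<lambda>x. a * x + b", OF f'(2)])
       (auto intro!: derivative_eq_intros)
  moreover have "continuous_on UNIV (\<lambda>x. f' (a * x + b) * a)"
    by (intro continuous_intros continuous_on_compose2[OF f'(1)]) auto
  ultimately show ?thesis unfolding C1_line_def by blast
qed

section \<open>Density of test profiles in \<open>L\<^sup>2\<close>\<close>

lemma has_real_derivative_pos_part_sq:
  "((\<lambda>x. (max 0 (x::real))\<^sup>2) has_real_derivative 2 * max 0 x) (at x)"
proof -
  consider "x < 0" | "x > 0" | "x = 0" by linarith
  then show ?thesis
  proof cases
    case 1
    have "((\<lambda>x. 0) has_real_derivative 2 * max 0 x) (at x)"
      using 1 by simp
    then show ?thesis
      by (rule has_field_derivative_transform_within_open[where S = "{..<0}"]) (use 1 in auto)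
  next
    case 2
    have "((\<lambda>x. x\<^sup>2) has_real_derivative 2 * max 0 x) (at x)"
      using 2 by (auto intro!: derivative_eq_intros)
    then show ?thesis
      by (rule has_field_derivative_transform_within_open[where S = "{0<..}"]) (use 2 in auto)
  next
    case 3
    have "((\<lambda>h. ((max 0 h)\<^sup>2) / h) \<longlongrightarrow> 0) (at (0::real))"
    proof (rule Lim_null_comparison)
      have "norm ((max 0 h)\<^sup>2 / h) \<le> \<bar>h\<bar>" for h :: real
        by (auto simp: max_def power2_eq_square)
      then show "\<forall>\<^sub>F h in at 0. norm ((max 0 h)\<^sup>2 / h) \<le> \<bar>h::real\<bar>"
        by simp
      show "((\<lambda>h. \<bar>h\<bar>) \<longlongrightarrow> 0) (at (0::real))"
        by (rule tendsto_rabs_zero) (rule tendsto_ident_at)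
    qed
    then show ?thesis
      using 3 by (simp add: DERIV_def)
  qed
qed

text \<open>
  Scalar test profiles: \<open>C\<^sup>1\<close> functions on the line that vanish outside \<open>(0,L)\<close>. Requiring
  differentiability on the whole line forces value and derivative to vanish at both ends.
\<close>

definition test_fun :: "real \<Rightarrow> (real \<Rightarrow> real) \<Rightarrow> bool" where
  "test_fun L \<psi> \<longleftrightarrow>
     C1_line \<psi> \<and> (\<forall>x. x \<notin> {0<..<L} \<longrightarrow> \<psi> x = 0)"

lemma test_fun_continuous: "test_fun L \<psi> \<Longrightarrow> continuous_on S \<psi>"
  unfolding test_fun_def by (simp add: C1_line_continuous)

text \<open>
  A \<open>C\<^sup>1\<close> weight that is positive exactly on \<open>(0,L)\<close>; the squared positive parts give it double
  zeros at the end points.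
\<close>

definition bump :: "real \<Rightarrow> real \<Rightarrow> real" where
  "bump L x = (max 0 x)\<^sup>2 * (max 0 (L - x))\<^sup>2"

lemma bump_nonneg: "0 \<le> bump L x"
  by (simp add: bump_def)

lemma bump_pos: "x \<in> {0<..<L} \<Longrightarrow> 0 < bump L x"
  by (simp add: bump_def)

lemma bump_eq_0: "x \<notin> {0<..<L} \<Longrightarrow> bump L x = 0"
  by (auto simp: bump_def max_def)

lemma continuous_on_bump: "continuous_on S (bump L)"
  unfolding bump_def by (intro continuous_intros)

lemma bump_le:
  assumes "L > 0" shows "bump L x \<le> L ^ 4"
proof (cases "x \<in> {0<..<L}")
  case True
  then have "(max 0 x)\<^sup>2 \<le> L\<^sup>2" "(max 0 (L - x))\<^sup>2 \<le> L\<^sup>2"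
    by (auto intro!: power_mono)
  then have "bump L x \<le> L\<^sup>2 * L\<^sup>2"
    unfolding bump_def by (intro mult_mono) auto
  then show ?thesis
    by (simp flip: power_add)
next
  case False
  then show ?thesis using assms by (simp add: bump_eq_0)
qed

lemma has_real_derivative_bump:
  "(bump L has_real_derivative
      (2 * max 0 x * (max 0 (L - x))\<^sup>2 - (max 0 x)\<^sup>2 * (2 * max 0 (L - x)))) (at x)"
proof -
  have "((\<lambda>x. (max 0 (L - x))\<^sup>2) has_real_derivative (2 * max 0 (L - x)) * (-1)) (at x)"
    by (rule DERIV_chain2[where f = "\<lambda>y. (max 0 y)\<^sup>2" and g = "\<lambda>x. L - x",
          OF has_real_derivative_pos_part_sq])
       (auto intro!: derivative_eq_intros)
  from DERIV_mult[OF has_real_derivative_pos_part_sq this]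
  show ?thesis
    unfolding bump_def[abs_def] by (simp add: algebra_simps)
qed

lemma test_fun_bump_mult:
  assumes "real_polynomial_function p"
  shows "test_fun L (\<lambda>x. bump L x * p x)"
proof -
  obtain p' where p': "real_polynomial_function p'"
      "\<And>x. (p has_real_derivative p' x) (at x)"
    using has_real_derivative_polynomial_function[OF assms] by blast
  let ?b = "\<lambda>x. 2 * max 0 x * (max 0 (L - x))\<^sup>2 - (max 0 x)\<^sup>2 * (2 * max 0 (L - x))"
  have c: "continuous_on UNIV p" "continuous_on UNIV p'"
    using assms p'(1) by (auto intro: continuous_on_polymonial_function simp: real_polynomial_function_eq)
  have "((\<lambda>x. bump L x * p x) has_real_derivative (?b x * p x + p' x * bump L x)) (at x)" for x
    by (rule DERIV_mult[OF has_real_derivative_bump p'(2)])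
  moreover have "continuous_on UNIV (\<lambda>x. ?b x * p x + p' x * bump L x)"
    by (intro continuous_intros c continuous_on_bump)
  moreover have "\<forall>x. x \<notin> {0<..<L} \<longrightarrow> bump L x * p x = 0"
    by (simp add: bump_eq_0)
  ultimately show ?thesis
    unfolding test_fun_def C1_line_def by blast
qed

text \<open>
  The quotient of \<open>r\<close> by the weight is bounded and measurable, hence almost everywhere a limit of
  uniformly bounded continuous functions, which may be replaced by polynomials on \<open>[0,L]\<close>;
  multiplication by the weight turns these into test profiles.
\<close>

lemma bounded_approx_test_fun:
  fixes r :: "real \<Rightarrow> real"
  assumes L: "L > 0" and r: "r \<in> borel_measurable (lebesgue_on {0<..<L})"
    and B: "\<And>x. x \<in> {0<..<L} \<Longrightarrow> \<bar>r x\<bar> \<le> B" and "\<delta> > 0"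
    and \<delta>: "\<And>x. x \<in> {0<..<L} \<Longrightarrow> r x \<noteq> 0 \<Longrightarrow> \<delta> \<le> bump L x"
  obtains \<psi> B' where "\<And>n::nat. test_fun L (\<psi> n)" "\<And>n x. \<bar>\<psi> n x\<bar> \<le> B'"
    "AE x in lebesgue_on {0<..<L}. (\<lambda>n. \<psi> n x) \<longlonglongrightarrow> r x"
proof -
  have B0: "B \<ge> 0" using B[of "L/2"] L by auto
  define C where "C = B / \<delta>"
  have C0: "C \<ge> 0" using B0 \<open>\<delta> > 0\<close> by (simp add: C_def)
  let ?q = "\<lambda>x. r x / bump L x"
  have q_le: "\<bar>?q x\<bar> \<le> C" if x: "x \<in> {0<..<L}" for x
  proof (cases "r x = 0")
    case True then show ?thesis using C0 by simp
  next
    case False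
    then have "\<bar>r x\<bar> / bump L x \<le> B / \<delta>"
      using x \<delta>[OF x] B[OF x] \<open>\<delta> > 0\<close> by (intro frac_le) auto
    then show ?thesis by (simp add: C_def bump_nonneg abs_mult)
  qed
  have "?q \<in> borel_measurable (lebesgue_on {0<..<L})"
    using r continuous_imp_measurable_on_sets_lebesgue[OF continuous_on_bump[of "{0<..<L}" L]]
    by (intro borel_measurable_divide) auto
  then have "?q measurable_on {0<..<L}"
    by (simp add: measurable_on_iff_borel_measurable)
  then obtain N g where N: "negligible N" and g: "\<And>n::nat. continuous_on UNIV (g n)"
    and glim: "\<And>x. x \<notin> N \<Longrightarrow> (\<lambda>n. g n x) \<longlonglongrightarrow> (if x \<in> {0<..<L} then ?q x else 0)"
    unfolding measurable_on_def by blast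
  \<comment> \<open>Cutting off at \<open>\<plusminus>C\<close> keeps the limit, because the quotient is bounded by \<open>C\<close>.\<close>
  define G where "G n x = max (- C) (min C (g n x))" for n x
  have "\<exists>P. real_polynomial_function P \<and> (\<forall>x\<in>{0..L}. \<bar>G n x - P x\<bar> < 1 / real (Suc n))" for n
  proof -
    have "continuous_on {0..L} (G n)"
      unfolding G_def by (intro continuous_intros continuous_on_subset[OF g]) auto
    from Stone_Weierstrass_real_polynomial_function[OF _ this, of "1 / real (Suc n)"]
    show ?thesis by (metis compact_Icc divide_pos_pos of_nat_0_less_iff zero_less_Suc zero_less_one)
  qed
  then obtain P where P: "\<And>n. real_polynomial_function (P n)"
    and PG: "\<And>n x. x \<in> {0..L} \<Longrightarrow> \<bar>G n x - P n x\<bar> < 1 / real (Suc n)"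
    by metis
  let ?\<psi> = "\<lambda>n x. bump L x * P n x"
  show ?thesis
  proof (rule that)
    show "test_fun L (?\<psi> n)" for n
      by (rule test_fun_bump_mult[OF P])
    show "\<bar>?\<psi> n x\<bar> \<le> L ^ 4 * (C + 1)" for n x
    proof (cases "x \<in> {0<..<L}")
      case True
      then have "\<bar>G n x - P n x\<bar> < 1 / real (Suc n)"
        by (intro PG) auto
      also have "\<dots> \<le> 1" by simp
      finally have "\<bar>P n x\<bar> \<le> C + 1"
        using C0 by (auto simp: G_def)
      then show ?thesis
        unfolding abs_mult using bump_nonneg[of L x] bump_le[OF L, of x] C0
        by (intro mult_mono) auto
    next
      case False
      then show ?thesis using C0 L by (simp add: bump_eq_0)
    qed
    have "(\<lambda>n. ?\<psi> n x) \<longlonglongrightarrow> r x" if "x \<notin> N" "x \<in> {0<..<L}" for x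
    proof -
      have "(\<lambda>n. max (- C) (min C (g n x))) \<longlonglongrightarrow> max (- C) (min C (?q x))"
        using glim[OF that(1)] that(2) by (intro tendsto_intros) simp
      moreover have "max (- C) (min C (?q x)) = ?q x"
        using q_le[OF that(2)] by (simp only: abs_le_iff) (simp add: max_def min_def)
      ultimately have 1: "(\<lambda>n. G n x) \<longlonglongrightarrow> ?q x"
        by (simp add: G_def)
      have 2: "(\<lambda>n. G n x - P n x) \<longlonglongrightarrow> 0"
      proof (rule Lim_null_comparison)
        show "\<forall>\<^sub>F n in sequentially. norm (G n x - P n x) \<le> 1 / real (Suc n)"
          using PG[of x] that(2) by (intro always_eventually) (auto intro!: less_imp_le)
        show "(\<lambda>n. 1 / real (Suc n)) \<longlonglongrightarrow> 0"
          using LIMSEQ_inverse_real_of_nat by (simp add: inverse_eq_divide)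
      qed
      have "(\<lambda>n. bump L x * (G n x - (G n x - P n x))) \<longlonglongrightarrow> bump L x * (?q x - 0)"
        by (intro tendsto_intros 1 2)
      then show ?thesis using bump_pos[OF that(2)] by simp
    qed
    moreover have "N \<in> null_sets lebesgue"
      using N by (simp add: negligible_iff_null_sets)
    then have "AE x in lebesgue. x \<notin> N"
      by (rule AE_not_in)
    then have "AE x in lebesgue_on {0<..<L}. x \<notin> N"
      by (subst AE_restrict_space_iff) auto
    ultimately show "AE x in lebesgue_on {0<..<L}. (\<lambda>n. ?\<psi> n x) \<longlonglongrightarrow> r x"
      by (elim AE_mp) (auto intro!: AE_I2)
  qed
qed

text \<open>
  Density of the test profiles in \<open>L\<^sup>2\<close>, in the form in which it is used: the square norm of \<open>R\<close> is at
  most \<open>D\<close> as soon as every test profile \<open>\<psi>\<close> pairs with \<open>R\<close> to at most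
  \<open>(\<parallel>\<psi>\<parallel>\<^sup>2 + D) / 2\<close>. The test profiles approximate the truncation of \<open>R\<close> to the set where \<open>R\<close> is not
  too large and the weight not too small; for \<open>\<psi>\<close> equal to that truncation, the hypothesis reads
  \<open>\<parallel>\<psi>\<parallel>\<^sup>2 \<le> D\<close>.
\<close>

lemma L2_bound_by_testing:
  fixes R :: "real \<Rightarrow> real^'n"
  assumes L: "L > 0" and R: "R \<in> L2 L"
    and test: "\<And>\<psi>. (\<And>j. test_fun L (\<lambda>x. \<psi> x $ j)) \<Longrightarrow>
        (LINT x|lebesgue_on {0<..<L}. \<psi> x \<bullet> R x)
          \<le> ((LINT x|lebesgue_on {0<..<L}. (norm (\<psi> x))\<^sup>2) + D) / 2"
  shows "(LINT x|lebesgue_on {0<..<L}. (norm (R x))\<^sup>2) \<le> D"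
proof -
  let ?M = "lebesgue_on {0<..<L}"
  interpret finite_measure ?M
    by (rule finite_measure_lebesgue_on) simp
  have Rm: "R \<in> borel_measurable ?M" and Ri: "integrable ?M (\<lambda>x. (norm (R x))\<^sup>2)"
    using R by (auto simp: L2_def)
  have Ri1: "integrable ?M (\<lambda>x. norm (R x))"
  proof (rule Bochner_Integration.integrable_bound)
    show "integrable ?M (\<lambda>x. 1 + (norm (R x))\<^sup>2)" using Ri by simp
    have "a \<le> 1 + a\<^sup>2" for a :: real
      using zero_le_power2[of "a - 1"] zero_le_power2[of a]
      unfolding power2_diff mult_1_right one_power2 by linarith
    then show "AE x in ?M. norm (norm (R x)) \<le> norm (1 + (norm (R x))\<^sup>2)"
      by simp
  qed (use Rm in measurable)
  have bm: "bump L \<in> borel_measurable ?M"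
    using continuous_imp_measurable_on_sets_lebesgue[OF continuous_on_bump[of "{0<..<L}" L]] by simp
  define E where "E k = {x \<in> space ?M. norm (R x) \<le> real k \<and> 1 / real (Suc k) \<le> bump L x}" for k
  have E: "E k \<in> sets ?M" for k
    unfolding E_def using Rm bm by measurable
  have trunc: "(LINT x|?M. indicator (E k) x * (norm (R x))\<^sup>2) \<le> D" for k
  proof -
    define r where "r j x = indicator (E k) x * R x $ j" for j x
    have "\<exists>\<psi> B'. (\<forall>n::nat. test_fun L (\<psi> n)) \<and> (\<forall>n x. \<bar>\<psi> n x\<bar> \<le> B') \<and>
        (AE x in ?M. (\<lambda>n. \<psi> n x) \<longlonglongrightarrow> r j x)" for j
    proof -
      have "(\<lambda>x. R x $ j) \<in> borel_measurable ?M"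
        using borel_measurable_inner[OF Rm borel_measurable_const[of "axis j 1"]]
        by (simp add: inner_axis)
      then have 1: "r j \<in> borel_measurable ?M"
        unfolding r_def using E by measurable
      have 2: "\<bar>r j x\<bar> \<le> real k" for x
        using component_le_norm_cart[of "R x" j] by (auto simp: r_def E_def indicator_def)
      have 3: "r j x \<noteq> 0 \<Longrightarrow> 1 / real (Suc k) \<le> bump L x" for x
        by (auto simp: r_def E_def indicator_def)
      show ?thesis
        by (rule bounded_approx_test_fun[OF L 1 2, of "1 / real (Suc k)"]) (use 3 in auto)
    qed
    then obtain \<psi> B' where psi: "\<And>j (n::nat). test_fun L (\<psi> j n)"
      and psiB: "\<And>j n x. \<bar>\<psi> j n x\<bar> \<le> B' j"
      and psilim: "\<And>j. AE x in ?M. (\<lambda>n. \<psi> j n x) \<longlonglongrightarrow> r j x"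
      by metis
    define \<Psi> where "\<Psi> n x = (\<chi> j. \<psi> j n x)" for n x
    define B where "B = (\<Sum>j\<in>UNIV. B' j)"
    have PsiB: "norm (\<Psi> n x) \<le> B" for n x
      unfolding B_def
      by (rule order_trans[OF norm_le_l1_cart]) (auto simp: \<Psi>_def intro!: sum_mono psiB)
    have "AE x in ?M. \<forall>j\<in>UNIV. (\<lambda>n. \<psi> j n x) \<longlonglongrightarrow> r j x"
      using psilim by (intro AE_finite_allI) auto
    then have lim: "AE x in ?M. (\<lambda>n. \<Psi> n x) \<longlonglongrightarrow> indicator (E k) x *\<^sub>R R x"
    proof eventually_elim
      case (elim x)
      show ?case
        by (rule vec_tendstoI) (use elim in \<open>auto simp: \<Psi>_def r_def\<close>)
    qed
    have Psim: "\<Psi> n \<in> borel_measurable ?M" for n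
    proof -
      have "continuous_on {0<..<L} (\<Psi> n)"
        unfolding \<Psi>_def by (intro continuous_intros test_fun_continuous[OF psi])
      then show ?thesis by (rule continuous_imp_measurable_on_sets_lebesgue) simp
    qed
    have i1: "(\<lambda>n. LINT x|?M. \<Psi> n x \<bullet> R x) \<longlonglongrightarrow> (LINT x|?M. (indicator (E k) x *\<^sub>R R x) \<bullet> R x)"
    proof (rule integral_dominated_convergence[where w = "\<lambda>x. B * norm (R x)"])
      show "AE x in ?M. (\<lambda>n. \<Psi> n x \<bullet> R x) \<longlonglongrightarrow> (indicator (E k) x *\<^sub>R R x) \<bullet> R x"
        using lim by eventually_elim (intro tendsto_intros)
      show "AE x in ?M. norm (\<Psi> n x \<bullet> R x) \<le> B * norm (R x)" for n
      proof (rule AE_I2)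
        fix x
        have "norm (\<Psi> n x \<bullet> R x) \<le> norm (\<Psi> n x) * norm (R x)"
          by (simp add: Cauchy_Schwarz_ineq2)
        also have "\<dots> \<le> B * norm (R x)"
          by (intro mult_right_mono PsiB) auto
        finally show "norm (\<Psi> n x \<bullet> R x) \<le> B * norm (R x)" .
      qed
    qed (use Psim Rm Ri1 E in \<open>auto intro!: borel_measurable_inner borel_measurable_scaleR borel_measurable_indicator\<close>)
    have i2: "(\<lambda>n. LINT x|?M. (norm (\<Psi> n x))\<^sup>2) \<longlonglongrightarrow> (LINT x|?M. (norm (indicator (E k) x *\<^sub>R R x))\<^sup>2)"
    proof (rule integral_dominated_convergence[where w = "\<lambda>x. B\<^sup>2"])
      show "AE x in ?M. (\<lambda>n. (norm (\<Psi> n x))\<^sup>2) \<longlonglongrightarrow> (norm (indicator (E k) x *\<^sub>R R x))\<^sup>2"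
        using lim by eventually_elim (intro tendsto_intros)
      show "AE x in ?M. norm ((norm (\<Psi> n x))\<^sup>2) \<le> B\<^sup>2" for n
        using PsiB by (auto intro!: AE_I2 power_mono)
    qed (use Psim Rm E in \<open>auto intro!: borel_measurable_power borel_measurable_norm borel_measurable_scaleR borel_measurable_indicator\<close>)
    have e1: "(indicator (E k) x *\<^sub>R R x) \<bullet> R x = indicator (E k) x * (norm (R x))\<^sup>2" for x
      by (simp add: power2_norm_eq_inner)
    have e2: "(norm (indicator (E k) x *\<^sub>R R x))\<^sup>2 = indicator (E k) x * (norm (R x))\<^sup>2" for x
      by (simp add: indicator_def)
    have "(LINT x|?M. indicator (E k) x * (norm (R x))\<^sup>2)
        \<le> ((LINT x|?M. indicator (E k) x * (norm (R x))\<^sup>2) + D) / 2"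
    proof (rule LIMSEQ_le)
      show "(\<lambda>n. LINT x|?M. \<Psi> n x \<bullet> R x) \<longlonglongrightarrow> (LINT x|?M. indicator (E k) x * (norm (R x))\<^sup>2)"
        using i1 by (simp only: e1)
      show "(\<lambda>n. ((LINT x|?M. (norm (\<Psi> n x))\<^sup>2) + D) / 2)
          \<longlonglongrightarrow> ((LINT x|?M. indicator (E k) x * (norm (R x))\<^sup>2) + D) / 2"
        using i2 by (intro tendsto_intros) (auto simp only: e2)
      show "\<exists>N. \<forall>n\<ge>N. (LINT x|?M. \<Psi> n x \<bullet> R x) \<le> ((LINT x|?M. (norm (\<Psi> n x))\<^sup>2) + D) / 2"
        using psi by (intro exI[of _ 0] allI impI test) (simp add: \<Psi>_def)
    qed
    then show ?thesis by simp
  qed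
  have "(\<lambda>k. LINT x|?M. indicator (E k) x * (norm (R x))\<^sup>2) \<longlonglongrightarrow> (LINT x|?M. (norm (R x))\<^sup>2)"
  proof (rule integral_dominated_convergence[OF _ _ Ri])
    show "AE x in ?M. (\<lambda>k. indicator (E k) x * (norm (R x))\<^sup>2) \<longlonglongrightarrow> (norm (R x))\<^sup>2"
    proof (rule AE_I2)
      fix x assume x: "x \<in> space ?M"
      then have b: "bump L x > 0" by (simp add: bump_pos)
      obtain k1 where k1: "norm (R x) \<le> real k1" using real_arch_simple by blast
      obtain k2 where k2: "1 / bump L x \<le> real k2" using real_arch_simple by blast
      have "x \<in> E k" if "k \<ge> max k1 k2" for k
      proof -
        have "1 / bump L x \<le> real (Suc k)" using k2 that by auto
        then have "1 / real (Suc k) \<le> bump L x"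
          using b by (simp add: field_simps)
        then show ?thesis using k1 that x by (auto simp: E_def)
      qed
      then have "\<forall>\<^sub>F k in sequentially. indicator (E k) x * (norm (R x))\<^sup>2 = (norm (R x))\<^sup>2"
        by (intro eventually_sequentiallyI[of "max k1 k2"]) auto
      then show "(\<lambda>k. indicator (E k) x * (norm (R x))\<^sup>2) \<longlonglongrightarrow> (norm (R x))\<^sup>2"
        by (rule tendsto_eventually)
    qed
    show "AE x in ?M. norm (indicator (E k) x * (norm (R x))\<^sup>2) \<le> (norm (R x))\<^sup>2" for k
      by (rule AE_I2) (simp add: indicator_def)
  qed (use Rm E in \<open>auto intro!: borel_measurable_power borel_measurable_norm borel_measurable_times borel_measurable_indicator\<close>)
  then show ?thesis
    by (rule LIMSEQ_le_const2) (use trunc in auto)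
qed

section \<open>The scalar delay equation\<close>

text \<open>
  Picard iterates, started at zero, for the delay equation \<open>\<sigma>(s) = f(s) + \<Sum>\<^sub>k c\<^sub>k \<sigma>(s - d\<^sub>k)\<close>,
  where \<open>f\<close> and \<open>\<sigma>\<close> vanish on the negative half line.
\<close>

primrec delay_iter ::
    "('n::finite \<Rightarrow> real) \<Rightarrow> ('n \<Rightarrow> real) \<Rightarrow> (real \<Rightarrow> real) \<Rightarrow> nat \<Rightarrow> real \<Rightarrow> real" where
  "delay_iter c d f 0 = (\<lambda>s. 0)"
| "delay_iter c d f (Suc N) = (\<lambda>s. f s + (\<Sum>k\<in>UNIV. c k * delay_iter c d f N (s - d k)))"

lemma C1_line_delay_iter: "C1_line f \<Longrightarrow> C1_line (delay_iter c d f N)"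
proof (induction N)
  case (Suc N)
  have "C1_line (\<lambda>s. delay_iter c d f N (s - d k))" for k
    using C1_line_affine[OF Suc.IH[OF Suc.prems], of 1 "- d k"] by simp
  then show ?case
    using Suc.prems by (auto intro!: C1_line_add C1_line_sum C1_line_cmult)
qed (simp add: C1_line_const)

lemma delay_iter_nonpos:
  assumes "\<And>s. s \<le> 0 \<Longrightarrow> f s = 0" "\<And>k. d k \<ge> 0" "s \<le> 0"
  shows "delay_iter c d f N s = 0"
  using assms(3)
proof (induction N arbitrary: s)
  case (Suc N)
  have "delay_iter c d f N (s - d k) = 0" for k
    using Suc.prems assms(2)[of k] by (intro Suc.IH) auto
  then show ?case using Suc.prems assms(1) by simp
qed simp

text \<open>
  The \<open>N\<close>-th iterate already solves the equation up to time \<open>N m\<close>, where \<open>m\<close> is a lower bound of the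
  delays: each further iteration changes values only beyond that time.
\<close>

lemma delay_iter_fixed_point:
  assumes f: "\<And>s. s \<le> 0 \<Longrightarrow> f s = 0" and m: "m \<ge> 0" "\<And>k. m \<le> d k" and "s \<le> real N * m"
  shows "delay_iter c d f N s = f s + (\<Sum>k\<in>UNIV. c k * delay_iter c d f N (s - d k))"
proof -
  have "delay_iter c d f (Suc N) s = delay_iter c d f N s"
    using assms(4)
  proof (induction N arbitrary: s)
    case 0
    have "d k \<ge> 0" for k using m order_trans by blast
    then show ?case using 0 delay_iter_nonpos[of f d s c "Suc 0"] f by simp
  next
    case (Suc N)
    have "delay_iter c d f (Suc N) (s - d k) = delay_iter c d f N (s - d k)" for k
      using Suc.prems m(2)[of k] by (intro Suc.IH) (simp add: algebra_simps)
    then show ?case unfolding delay_iter.simps(2)[of c d f "Suc N"]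
      by (simp only: delay_iter.simps(2)[of c d f N, symmetric]) (simp only: delay_iter.simps(2))
  qed
  then show ?thesis by simp
qed

text \<open>
  Exponentially weighted square of \<open>f\<close> and its integral over the whole line. The weight is what
  turns an energy bound that is uniform in time into exponential decay.
\<close>

definition wsq :: "real \<Rightarrow> (real \<Rightarrow> real) \<Rightarrow> real \<Rightarrow> real" where
  "wsq \<nu> f s = exp (2 * \<nu> * s) * (f s)\<^sup>2"

definition energy :: "real \<Rightarrow> (real \<Rightarrow> real) \<Rightarrow> real" where
  "energy \<nu> f = (LINT s|lborel. wsq \<nu> f s)"

lemma wsq_nonneg: "wsq \<nu> f s \<ge> 0"
  by (simp add: wsq_def)

lemma wsq_eq_0: "f s = 0 \<Longrightarrow> wsq \<nu> f s = 0"
  by (simp add: wsq_def)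

lemma energy_nonneg: "energy \<nu> f \<ge> 0"
  unfolding energy_def by (simp add: wsq_nonneg)

lemma continuous_on_wsq: "continuous_on S f \<Longrightarrow> continuous_on S (wsq \<nu> f)"
  unfolding wsq_def[abs_def] by (intro continuous_intros)

lemma wsq_measurable: "continuous_on UNIV f \<Longrightarrow> wsq \<nu> f \<in> borel_measurable borel"
  by (intro borel_measurable_continuous_onI continuous_on_wsq)

lemma has_bochner_integral_wsq_shift:
  assumes "integrable lborel (wsq \<nu> f)"
  shows "has_bochner_integral lborel (wsq \<nu> (\<lambda>s. f (s - d))) (exp (2 * \<nu> * d) * energy \<nu> f)"
proof -
  have "has_bochner_integral lborel (wsq \<nu> f) (energy \<nu> f)"
    using assms unfolding energy_def by (rule has_bochner_integral_integrable)
  then have "has_bochner_integral lborel (\<lambda>s. wsq \<nu> f (- d + 1 * s)) (energy \<nu> f /\<^sub>R \<bar>1\<bar>)"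
    by (subst (asm) lborel_has_bochner_integral_real_affine_iff[of 1 _ _ "- d"]) auto
  then have "has_bochner_integral lborel (\<lambda>s. exp (2 * \<nu> * d) * wsq \<nu> f (- d + 1 * s))
      (exp (2 * \<nu> * d) * (energy \<nu> f /\<^sub>R \<bar>1\<bar>))"
    by (rule has_bochner_integral_mult_right)
  moreover have "exp (2 * \<nu> * d) * wsq \<nu> f (- d + 1 * s) = wsq \<nu> (\<lambda>s. f (s - d)) s" for s
    by (simp add: wsq_def algebra_simps flip: exp_add)
  ultimately show ?thesis by simp
qed

text \<open>
  Jensen's inequality for the square and the weights \<open>\<bar>c\<^sub>k\<bar>\<close>, completed to total weight one by
  \<open>1 - \<Sum>\<^sub>k \<bar>c\<^sub>k\<bar>\<close>.
\<close>

lemma affine_combination_square_le: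
  fixes c s :: "'a \<Rightarrow> real"
  assumes "finite A" and \<rho>: "(\<Sum>k\<in>A. \<bar>c k\<bar>) < 1"
  shows "(a + (\<Sum>k\<in>A. c k * s k))\<^sup>2 \<le> a\<^sup>2 / (1 - (\<Sum>k\<in>A. \<bar>c k\<bar>)) + (\<Sum>k\<in>A. \<bar>c k\<bar> * (s k)\<^sup>2)"
proof -
  define \<rho> where "\<rho> = (\<Sum>k\<in>A. \<bar>c k\<bar>)"
  define y where "y = a + (\<Sum>k\<in>A. c k * s k)"
  have pos: "1 - \<rho> > 0" using \<rho> by (simp add: \<rho>_def)
  have 1: "2 * (c k * s k) * y \<le> \<bar>c k\<bar> * (s k)\<^sup>2 + \<bar>c k\<bar> * y\<^sup>2" for k
  proof -
    have "2 * (s k * y) \<le> (s k)\<^sup>2 + y\<^sup>2" "- (2 * (s k * y)) \<le> (s k)\<^sup>2 + y\<^sup>2"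
      using zero_le_power2[of "s k - y"] zero_le_power2[of "s k + y"]
      unfolding power2_diff power2_sum by linarith+
    then have "\<bar>2 * (s k * y)\<bar> \<le> (s k)\<^sup>2 + y\<^sup>2" by linarith
    then have "\<bar>c k\<bar> * \<bar>2 * (s k * y)\<bar> \<le> \<bar>c k\<bar> * ((s k)\<^sup>2 + y\<^sup>2)"
      by (rule mult_left_mono) simp
    moreover have "2 * (c k * s k) * y \<le> \<bar>c k\<bar> * \<bar>2 * (s k * y)\<bar>"
      unfolding abs_mult[symmetric] by (rule order_trans[OF _ abs_ge_self]) simp
    ultimately show ?thesis by (simp add: algebra_simps)
  qed
  have 2: "2 * a * y \<le> a\<^sup>2 / (1 - \<rho>) + (1 - \<rho>) * y\<^sup>2"
  proof -
    have "0 \<le> (a - (1 - \<rho>) * y)\<^sup>2 / (1 - \<rho>)" using pos by simp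
    also have "\<dots> = a\<^sup>2 / (1 - \<rho>) + (1 - \<rho>) * y\<^sup>2 - 2 * a * y"
      using pos by (simp add: field_simps power2_eq_square)
    finally show ?thesis by simp
  qed
  have "2 * y\<^sup>2 = 2 * a * y + (\<Sum>k\<in>A. 2 * (c k * s k) * y)"
    unfolding sum_distrib_right[symmetric] sum_distrib_left[symmetric]
    by (simp add: y_def power2_eq_square algebra_simps)
  also have "\<dots> \<le> (a\<^sup>2 / (1 - \<rho>) + (1 - \<rho>) * y\<^sup>2) + (\<Sum>k\<in>A. \<bar>c k\<bar> * (s k)\<^sup>2 + \<bar>c k\<bar> * y\<^sup>2)"
    by (intro add_mono sum_mono 1 2)
  also have "\<dots> = a\<^sup>2 / (1 - \<rho>) + (\<Sum>k\<in>A. \<bar>c k\<bar> * (s k)\<^sup>2) + y\<^sup>2"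
    by (simp add: sum.distrib sum_distrib_right[symmetric] \<rho>_def[symmetric] algebra_simps)
  finally show ?thesis by (simp add: y_def \<rho>_def)
qed

text \<open>
  The bound does not depend on \<open>N\<close>, because a shift by \<open>d\<^sub>k\<close> multiplies the weighted energy by
  \<open>exp (2 \<nu> d\<^sub>k)\<close>, so that one iteration contracts it up to the contribution of \<open>f\<close>.
\<close>

lemma energy_delay_iter:
  assumes f: "C1_line f" "integrable lborel (wsq \<nu> f)"
    and \<rho>: "(\<Sum>k\<in>UNIV. \<bar>c k\<bar>) < 1" and \<rho>': "(\<Sum>k\<in>UNIV. \<bar>c k\<bar> * exp (2 * \<nu> * d k)) < 1"
  shows "integrable lborel (wsq \<nu> (delay_iter c d f N)) \<and>
    energy \<nu> (delay_iter c d f N)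
      \<le> energy \<nu> f / (1 - (\<Sum>k\<in>UNIV. \<bar>c k\<bar>)) / (1 - (\<Sum>k\<in>UNIV. \<bar>c k\<bar> * exp (2 * \<nu> * d k)))"
    (is "_ \<and> _ \<le> _ / ?a / ?b")
proof (induction N)
  case 0
  have "wsq \<nu> (\<lambda>s. 0) = (\<lambda>s. 0)" by (simp add: wsq_def fun_eq_iff)
  then show ?case using \<rho> \<rho>' energy_nonneg[of \<nu> f] by (simp add: energy_def)
next
  case (Suc N)
  let ?\<sigma> = "delay_iter c d f N"
  define h where "h s = wsq \<nu> f s / ?a + (\<Sum>k\<in>UNIV. \<bar>c k\<bar> * wsq \<nu> (\<lambda>s. ?\<sigma> (s - d k)) s)" for s
  define H where "H = energy \<nu> f / ?a + (\<Sum>k\<in>UNIV. \<bar>c k\<bar> * (exp (2 * \<nu> * d k) * energy \<nu> ?\<sigma>))"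
  have h: "has_bochner_integral lborel h H"
    unfolding h_def H_def
    by (intro has_bochner_integral_add has_bochner_integral_divide has_bochner_integral_sum
        has_bochner_integral_mult_right has_bochner_integral_wsq_shift)
       (use Suc.IH f(2) in \<open>auto simp: energy_def intro: has_bochner_integral_integrable\<close>)
  have le: "wsq \<nu> (delay_iter c d f (Suc N)) s \<le> h s" for s
  proof -
    have "wsq \<nu> (delay_iter c d f (Suc N)) s \<le> exp (2 * \<nu> * s) * ((f s)\<^sup>2 / ?a + (\<Sum>k\<in>UNIV. \<bar>c k\<bar> * (?\<sigma> (s - d k))\<^sup>2))"
      unfolding wsq_def delay_iter.simps
      by (intro mult_left_mono affine_combination_square_le \<rho>) auto
    also have "\<dots> = h s"
      by (simp add: h_def wsq_def distrib_left sum_distrib_left mult_ac)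
    finally show ?thesis .
  qed
  have int: "integrable lborel (wsq \<nu> (delay_iter c d f (Suc N)))"
  proof (rule Bochner_Integration.integrable_bound)
    show "integrable lborel h" using h by (simp add: has_bochner_integral_iff)
    show "wsq \<nu> (delay_iter c d f (Suc N)) \<in> borel_measurable lborel"
      unfolding measurable_lborel2
      by (intro wsq_measurable C1_line_continuous C1_line_delay_iter f(1))
    show "AE s in lborel. norm (wsq \<nu> (delay_iter c d f (Suc N)) s) \<le> norm (h s)"
      using le wsq_nonneg by (intro AE_I2) (simp only: real_norm_def, smt (verit))
  qed
  have "energy \<nu> (delay_iter c d f (Suc N)) \<le> integral\<^sup>L lborel h"
    unfolding energy_def using h le int
    by (intro integral_mono) (auto simp only: has_bochner_integral_iff)
  also have "\<dots> = energy \<nu> f / ?a + (1 - ?b) * energy \<nu> ?\<sigma>"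
    using h by (simp add: has_bochner_integral_iff H_def sum_distrib_left sum_distrib_right mult_ac)
  also have "\<dots> \<le> energy \<nu> f / ?a + (1 - ?b) * (energy \<nu> f / ?a / ?b)"
    using Suc.IH by (intro add_left_mono mult_left_mono) (auto intro!: sum_nonneg)
  also have "\<dots> = energy \<nu> f / ?a / ?b"
  proof -
    have *: "x + (1 - b) * (x / b) = x / b" if "b > 0" for x b :: real
      using that by (simp add: field_simps)
    show ?thesis by (rule *) (use \<rho>' in simp)
  qed
  finally show ?case using int by simp
qed

section \<open>Exponential stability by duality\<close>

text \<open>
  Classical solutions of the adjoint problem with a prescribed test profile at time \<open>T\<close>, and their
  decay as time runs backwards. With \<open>s = T - t\<close>, component \<open>j\<close> is a wave travelling towards
  \<open>x = 0\<close>, so \<open>\<phi>\<^sub>j(t,x) = W\<^sub>j(s + x/\<mu>\<^sub>j)/\<mu>\<^sub>j\<close>, where \<open>W\<^sub>j(s)/\<mu>\<^sub>j\<close> is its value at \<open>x = 0\<close>. The boundary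
  condition says that \<open>W\<^sub>j(s + L/\<mu>\<^sub>j) = q\<^sub>j \<sigma>(s)\<close> with \<open>\<sigma> = \<Sum>\<^sub>k p\<^sub>k W\<^sub>k\<close>, which is the delay equation for
  \<open>\<sigma>\<close> with coefficients \<open>p\<^sub>k q\<^sub>k\<close> and delays \<open>L/\<mu>\<^sub>k\<close>.
\<close>

lemma adjoint_solution:
  fixes \<mu> p q :: "real^'n::finite"
  assumes L: "L > 0" and \<mu>: "\<And>i. \<mu> $ i > 0"
    and \<nu>: "\<nu> > 0" and \<rho>: "(\<Sum>k\<in>UNIV. \<bar>p $ k * q $ k\<bar>) < 1"
    and \<rho>': "(\<Sum>k\<in>UNIV. \<bar>p $ k * q $ k\<bar> * exp (2 * \<nu> * (L / \<mu> $ k))) < 1"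
  shows "\<exists>C>0. \<forall>\<psi> T. T > 0 \<longrightarrow> (\<forall>j. test_fun L (\<lambda>x. \<psi> x $ j)) \<longrightarrow>
    (\<exists>\<phi> \<phi>t \<phi>x. C1_rectangle T L \<phi> \<phi>t \<phi>x \<and>
       (\<forall>t\<in>{0..T}. diag \<mu> *v \<phi> t L = transpose (outer p q) *v (diag \<mu> *v \<phi> t 0)) \<and>
       (\<forall>t x. \<phi>t t x + diag \<mu> *v \<phi>x t x = 0) \<and>
       (\<forall>x\<in>{0<..<L}. \<phi> T x = \<psi> x) \<and> continuous_on UNIV (\<phi> 0) \<and>
       (LINT x|lebesgue_on {0<..<L}. (norm (\<phi> 0 x))\<^sup>2)
         \<le> C * exp (- 2 * \<nu> * T) * (LINT x|lebesgue_on {0<..<L}. (norm (\<psi> x))\<^sup>2))"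
proof -
  define d where "d k = L / \<mu> $ k" for k
  define c where "c k = p $ k * q $ k" for k
  have d: "d k > 0" for k using L \<mu> by (simp add: d_def)
  define \<rho>1 where "\<rho>1 = 1 - (\<Sum>k\<in>UNIV. \<bar>c k\<bar>)"
  define \<rho>2 where "\<rho>2 = 1 - (\<Sum>k\<in>UNIV. \<bar>c k\<bar> * exp (2 * \<nu> * d k))"
  have \<rho>12: "\<rho>1 > 0" "\<rho>2 > 0" using \<rho> \<rho>' by (simp_all add: \<rho>1_def \<rho>2_def c_def d_def)
  define D where "D = (\<Sum>k\<in>UNIV. (p $ k)\<^sup>2) / \<rho>1 / \<rho>2"
  have D: "D \<ge> 0" using \<rho>12 by (simp add: D_def sum_nonneg)
  define a where "a = (\<Sum>k\<in>UNIV. \<mu> $ k * exp (2 * \<nu> * d k))"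
  have a0: "a \<ge> 0" using \<mu> unfolding a_def by (intro sum_nonneg) (simp add: less_imp_le)
  define C1 where "C1 = (\<Sum>j\<in>UNIV. (1 / \<mu> $ j) * (2 + 2 * (q $ j)\<^sup>2 * exp (2 * \<nu> * d j) * D))"
  have C1: "C1 \<ge> 0"
    unfolding C1_def using \<mu> D by (intro sum_nonneg mult_nonneg_nonneg) (auto intro: less_imp_le)
  define C where "C = C1 * a + 1"
  have "C > 0" using C1 a0 by (simp add: C_def add_nonneg_pos)
  show ?thesis
  proof (intro exI[of _ C] conjI \<open>C > 0\<close> allI impI)
    fix \<psi> :: "real \<Rightarrow> real^'n" and T :: real
    assume T: "T > 0" and "\<forall>j. test_fun L (\<lambda>x. \<psi> x $ j)"
    then have psi1: "C1_line (\<lambda>x. \<psi> x $ j)" and psi0: "x \<notin> {0<..<L} \<Longrightarrow> \<psi> x $ j = 0" for x j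
      by (auto simp: test_fun_def)
    have psic: "continuous_on S (\<lambda>x. \<psi> x $ j)" for j S
      by (rule C1_line_continuous[OF psi1])
    \<comment> \<open>\<open>g j\<close> is the part of \<open>W j\<close> that comes from the profile at time \<open>T\<close>, without reflections.\<close>
    define g where "g j s = \<mu> $ j * \<psi> (\<mu> $ j * s) $ j" for j s
    have g1: "C1_line (g j)" for j
      unfolding g_def using C1_line_cmult[OF C1_line_affine[OF psi1, of "\<mu> $ j" 0 j]] by simp
    have g_neg: "g j s = 0" if "s \<le> 0" for j s
    proof -
      have "\<mu> $ j * s \<le> 0" using that \<mu>[of j] by (intro mult_nonneg_nonpos) auto
      then show ?thesis by (simp add: g_def psi0)
    qed
    have g_big: "g j s = 0" if "d j \<le> s" for j s
    proof -
      have "L \<le> \<mu> $ j * s" using that \<mu>[of j] by (simp add: d_def field_simps)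
      then show ?thesis by (simp add: g_def psi0)
    qed
    define f where "f s = (\<Sum>k\<in>UNIV. p $ k * g k s)" for s
    have f1: "C1_line f"
      unfolding f_def by (intro C1_line_sum C1_line_cmult g1) simp
    have f_neg: "f s = 0" if "s \<le> 0" for s
      using that by (simp add: f_def g_neg)
    define m where "m = Min (range d)"
    have m: "m > 0" "m \<le> d k" for k
      using d by (auto simp: m_def)
    \<comment> \<open>On \<open>[0,T]\<close> finitely many Picard steps suffice.\<close>
    obtain N :: nat where N: "T < real N * m"
      using reals_Archimedean3[OF m(1)] by blast
    define \<sigma> where "\<sigma> = delay_iter c d f N"
    have \<sigma>1: "C1_line \<sigma>" unfolding \<sigma>_def by (rule C1_line_delay_iter[OF f1])
    have \<sigma>_neg: "\<sigma> s = 0" if "s \<le> 0" for s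
      unfolding \<sigma>_def using f_neg d that by (intro delay_iter_nonpos) (auto intro: less_imp_le)
    have \<sigma>_eq: "\<sigma> s = f s + (\<Sum>k\<in>UNIV. c k * \<sigma> (s - d k))" if "s \<le> T" for s
      unfolding \<sigma>_def
      by (rule delay_iter_fixed_point[of f m]) (use f_neg m N that in \<open>auto intro: less_imp_le\<close>)
    define W where "W j s = g j s + q $ j * \<sigma> (s - d j)" for j s
    have W1: "C1_line (W j)" for j
      unfolding W_def using C1_line_affine[OF \<sigma>1, of 1 "- d j"]
      by (intro C1_line_add g1 C1_line_cmult) simp
    obtain W' where W'c: "\<And>j. continuous_on UNIV (W' j)"
      and W': "\<And>j s. (W j has_real_derivative W' j s) (at s)"
      using W1 unfolding C1_line_def by metis
    define \<phi> where "\<phi> t x = (\<chi> j. W j (T - t + x / \<mu> $ j) / \<mu> $ j)" for t x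
    define \<phi>t where "\<phi>t t x = (\<chi> j. - W' j (T - t + x / \<mu> $ j) / \<mu> $ j)" for t x
    define \<phi>x where "\<phi>x t x = (\<chi> j. W' j (T - t + x / \<mu> $ j) / \<mu> $ j / \<mu> $ j)" for t x
    have rect: "C1_rectangle T L \<phi> \<phi>t \<phi>x"
      unfolding C1_rectangle_def
    proof (intro conjI ballI)
      fix t x
      have "((\<lambda>s. W j (T - s + x / \<mu> $ j) / \<mu> $ j) has_real_derivative W' j (T - t + x / \<mu> $ j) * (- 1) / \<mu> $ j) (at t within {0..T})" for j
        by (intro DERIV_cdivide DERIV_chain2[OF W']) (auto intro!: derivative_eq_intros)
      then show "((\<lambda>s. \<phi> s x) has_vector_derivative \<phi>t t x) (at t within {0..T})"
        by (intro has_vector_derivative_vecI) (simp add: \<phi>_def \<phi>t_def)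
      have "((\<lambda>y. W j (T - t + y / \<mu> $ j) / \<mu> $ j) has_real_derivative W' j (T - t + x / \<mu> $ j) * (1 / \<mu> $ j) / \<mu> $ j) (at x within {0..L})" for j
        by (intro DERIV_cdivide DERIV_chain2[OF W'])
           (use \<mu>[of j] in \<open>auto intro!: derivative_eq_intros\<close>)
      then show "((\<lambda>y. \<phi> t y) has_vector_derivative \<phi>x t x) (at x within {0..L})"
        by (intro has_vector_derivative_vecI) (simp add: \<phi>_def \<phi>x_def)
    next
      show "continuous_on ({0..T} \<times> {0..L}) (\<lambda>(t, x). \<phi>t t x)"
        unfolding \<phi>t_def split_def divide_inverse
        by (intro continuous_intros continuous_on_compose2[OF W'c]) auto
      show "continuous_on ({0..T} \<times> {0..L}) (\<lambda>(t, x). \<phi>x t x)"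
        unfolding \<phi>x_def split_def divide_inverse
        by (intro continuous_intros continuous_on_compose2[OF W'c]) auto
    qed
    have bd: "diag \<mu> *v \<phi> t L = transpose (outer p q) *v (diag \<mu> *v \<phi> t 0)" if t: "t \<in> {0..T}" for t
    proof -
      have "W j (T - t + d j) = q $ j * (\<Sum>k\<in>UNIV. p $ k * W k (T - t))" for j
      proof -
        have "W j (T - t + d j) = q $ j * \<sigma> (T - t)"
          using t by (simp add: W_def g_big)
        also have "\<sigma> (T - t) = (\<Sum>k\<in>UNIV. p $ k * W k (T - t))"
          using t \<sigma>_eq[of "T - t"]
          by (simp add: W_def f_def c_def distrib_left sum.distrib mult.assoc)
        finally show ?thesis .
      qed
      then show ?thesis
        using \<mu>[THEN less_imp_neq, THEN not_sym]
        by (simp add: vec_eq_iff transpose_outer outer_mult_nth diag_mult_nth \<phi>_def d_def)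
    qed
    have pde: "\<phi>t t x + diag \<mu> *v \<phi>x t x = 0" for t x
      using \<mu>[THEN less_imp_neq, THEN not_sym]
      by (simp add: vec_eq_iff diag_mult_nth \<phi>t_def \<phi>x_def)
    have final: "\<phi> T x = \<psi> x" if x: "x \<in> {0<..<L}" for x
    proof -
      have "x / \<mu> $ j - d j \<le> 0" for j
        using x \<mu>[of j] by (simp add: d_def field_simps)
      then show ?thesis
        using \<mu>[THEN less_imp_neq, THEN not_sym]
        by (simp add: vec_eq_iff \<phi>_def W_def \<sigma>_neg g_def)
    qed
    have phic: "continuous_on UNIV (\<phi> 0)"
      unfolding \<phi>_def divide_inverse
      by (intro continuous_intros continuous_on_compose2[OF C1_line_continuous[OF W1, of UNIV]]) auto

    \<comment> \<open>The energies of \<open>g\<close>, \<open>f\<close>, \<open>\<sigma>\<close> and \<open>W\<close> are bounded in turn by multiples of \<open>\<Psi>\<close>; the constants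
      depend neither on \<open>\<psi>\<close> nor on \<open>T\<close>.\<close>
    define \<Psi> where "\<Psi> = (\<Sum>j\<in>UNIV. LINT x|lborel. (\<psi> x $ j)\<^sup>2)"
    define G where "G = (\<Sum>j\<in>UNIV. energy \<nu> (g j))"
    have G0: "G \<ge> 0" "energy \<nu> (g j) \<le> G" for j
      unfolding G_def by (auto intro: sum_nonneg energy_nonneg member_le_sum)
    have gint: "integrable lborel (wsq \<nu> (g j))" for j
      by (rule integrable_lborel_zero_outside[of _ 0 "d j"])
         (use C1_line_continuous[OF g1] in \<open>auto intro!: continuous_on_wsq wsq_eq_0 simp: g_neg g_big\<close>)
    have psi_int: "integrable lborel (\<lambda>x. (\<psi> x $ j)\<^sup>2)" for j
      by (rule integrable_lborel_zero_outside[of _ 0 L])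
         (auto intro!: continuous_intros psic simp: psi0)
    have Eg: "energy \<nu> (g j) \<le> \<mu> $ j * exp (2 * \<nu> * d j) * (LINT x|lborel. (\<psi> x $ j)\<^sup>2)" for j
    proof -
      let ?h = "\<lambda>x. exp (2 * \<nu> * d j) * (\<psi> x $ j)\<^sup>2"
      have i1: "integrable lborel (\<lambda>s. ?h (0 + \<mu> $ j * s))"
        using psi_int \<mu>[of j] by (intro lborel_integrable_real_affine) auto
      have "energy \<nu> (g j) \<le> (LINT s|lborel. (\<mu> $ j)\<^sup>2 * ?h (0 + \<mu> $ j * s))"
        unfolding energy_def
      proof (rule integral_mono)
        fix s
        show "wsq \<nu> (g j) s \<le> (\<mu> $ j)\<^sup>2 * ?h (0 + \<mu> $ j * s)"
        proof (cases "s \<le> d j")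
          case True
          then have "exp (2 * \<nu> * s) \<le> exp (2 * \<nu> * d j)" using \<nu> by simp
          then have "exp (2 * \<nu> * s) * (g j s)\<^sup>2 \<le> exp (2 * \<nu> * d j) * (g j s)\<^sup>2"
            by (rule mult_right_mono) simp
          then show ?thesis
            by (simp add: wsq_def g_def power_mult_distrib mult_ac)
        next
          case False
          then show ?thesis using g_big[of j s] by (simp add: wsq_def)
        qed
      qed (use gint i1 in auto)
      also have "\<dots> = (\<mu> $ j)\<^sup>2 * (LINT s|lborel. ?h (0 + \<mu> $ j * s))"
        by simp
      also have "(LINT s|lborel. ?h (0 + \<mu> $ j * s)) = (LINT x|lborel. ?h x) / \<mu> $ j"
        using lborel_integral_real_affine[of "\<mu> $ j" ?h 0] \<mu>[of j] by (simp add: field_simps)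
      also have "(LINT x|lborel. ?h x) = exp (2 * \<nu> * d j) * (LINT x|lborel. (\<psi> x $ j)\<^sup>2)"
        by simp
      finally show ?thesis using \<mu>[of j] by (simp add: power2_eq_square[of "\<mu> $ j"] mult.assoc)
    qed
    have G\<Psi>: "G \<le> a * \<Psi>"
    proof -
      have "G \<le> (\<Sum>j\<in>UNIV. a * (LINT x|lborel. (\<psi> x $ j)\<^sup>2))"
        unfolding G_def
      proof (rule sum_mono)
        fix j
        have "\<mu> $ j * exp (2 * \<nu> * d j) \<le> a"
          unfolding a_def using \<mu> by (intro member_le_sum) (auto intro: less_imp_le)
        then have "\<mu> $ j * exp (2 * \<nu> * d j) * (LINT x|lborel. (\<psi> x $ j)\<^sup>2)
            \<le> a * (LINT x|lborel. (\<psi> x $ j)\<^sup>2)"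
          by (rule mult_right_mono) simp
        with Eg[of j] show "energy \<nu> (g j) \<le> a * (LINT x|lborel. (\<psi> x $ j)\<^sup>2)" by simp
      qed
      then show ?thesis by (simp add: \<Psi>_def sum_distrib_left)
    qed
    have f_le: "wsq \<nu> f s \<le> (\<Sum>k\<in>UNIV. (p $ k)\<^sup>2) * (\<Sum>k\<in>UNIV. wsq \<nu> (g k) s)" for s
    proof -
      have "(f s)\<^sup>2 \<le> (\<Sum>k\<in>UNIV. (p $ k)\<^sup>2) * (\<Sum>k\<in>UNIV. (g k s)\<^sup>2)"
        unfolding f_def by (rule Cauchy_Schwarz_ineq_sum)
      then have "exp (2 * \<nu> * s) * (f s)\<^sup>2 \<le> exp (2 * \<nu> * s) * ((\<Sum>k\<in>UNIV. (p $ k)\<^sup>2) * (\<Sum>k\<in>UNIV. (g k s)\<^sup>2))"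
        by (rule mult_left_mono) simp
      moreover have "(\<Sum>k\<in>UNIV. wsq \<nu> (g k) s) = exp (2 * \<nu> * s) * (\<Sum>k\<in>UNIV. (g k s)\<^sup>2)"
        by (simp add: wsq_def sum_distrib_left)
      ultimately show ?thesis by (simp only: wsq_def[of \<nu> f] mult.left_commute)
    qed
    have fint: "integrable lborel (wsq \<nu> f)"
    proof (rule Bochner_Integration.integrable_bound)
      show "integrable lborel (\<lambda>s. (\<Sum>k\<in>UNIV. (p $ k)\<^sup>2) * (\<Sum>k\<in>UNIV. wsq \<nu> (g k) s))"
        using gint by auto
      show "wsq \<nu> f \<in> borel_measurable lborel"
        unfolding measurable_lborel2 by (intro wsq_measurable C1_line_continuous f1)
      show "AE s in lborel. norm (wsq \<nu> f s) \<le> norm ((\<Sum>k\<in>UNIV. (p $ k)\<^sup>2) * (\<Sum>k\<in>UNIV. wsq \<nu> (g k) s))"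
        using f_le wsq_nonneg[of \<nu> f] by (intro AE_I2) (simp only: real_norm_def, smt (verit))
    qed
    have Ef: "energy \<nu> f \<le> (\<Sum>k\<in>UNIV. (p $ k)\<^sup>2) * G"
    proof -
      have "energy \<nu> f \<le> (LINT s|lborel. (\<Sum>k\<in>UNIV. (p $ k)\<^sup>2) * (\<Sum>k\<in>UNIV. wsq \<nu> (g k) s))"
        unfolding energy_def using f_le fint gint by (intro integral_mono) auto
      also have "\<dots> = (\<Sum>k\<in>UNIV. (p $ k)\<^sup>2) * G"
        using gint by (simp add: G_def energy_def Bochner_Integration.integral_sum)
      finally show ?thesis .
    qed
    have \<sigma>int: "integrable lborel (wsq \<nu> \<sigma>)" and E\<sigma>': "energy \<nu> \<sigma> \<le> energy \<nu> f / \<rho>1 / \<rho>2"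
      using energy_delay_iter[OF f1 fint, of c d N] \<rho>12 unfolding \<rho>1_def \<rho>2_def \<sigma>_def by auto
    have E\<sigma>: "energy \<nu> \<sigma> \<le> D * G"
    proof -
      have "energy \<nu> f / \<rho>1 / \<rho>2 \<le> (\<Sum>k\<in>UNIV. (p $ k)\<^sup>2) * G / \<rho>1 / \<rho>2"
        using Ef \<rho>12 by (intro divide_right_mono) auto
      then show ?thesis using E\<sigma>' by (simp add: D_def)
    qed
    have W_le: "wsq \<nu> (W j) s \<le> 2 * wsq \<nu> (g j) s + 2 * (q $ j)\<^sup>2 * wsq \<nu> (\<lambda>s. \<sigma> (s - d j)) s" for j s
    proof -
      have "(x + y)\<^sup>2 \<le> 2 * x\<^sup>2 + 2 * y\<^sup>2" for x y :: real
        using zero_le_power2[of "x - y"] unfolding power2_diff power2_sum by linarith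
      then have "(W j s)\<^sup>2 \<le> 2 * (g j s)\<^sup>2 + 2 * (q $ j * \<sigma> (s - d j))\<^sup>2"
        by (simp add: W_def)
      then have "exp (2 * \<nu> * s) * (W j s)\<^sup>2 \<le> exp (2 * \<nu> * s) * (2 * (g j s)\<^sup>2 + 2 * (q $ j * \<sigma> (s - d j))\<^sup>2)"
        by (rule mult_left_mono) simp
      then show ?thesis by (simp add: wsq_def distrib_left power_mult_distrib mult_ac)
    qed
    have Wb: "has_bochner_integral lborel
        (\<lambda>s. 2 * wsq \<nu> (g j) s + 2 * (q $ j)\<^sup>2 * wsq \<nu> (\<lambda>s. \<sigma> (s - d j)) s)
        (2 * energy \<nu> (g j) + 2 * (q $ j)\<^sup>2 * (exp (2 * \<nu> * d j) * energy \<nu> \<sigma>))" for j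
      by (intro has_bochner_integral_add has_bochner_integral_mult_right has_bochner_integral_wsq_shift \<sigma>int)
         (use gint in \<open>auto simp: energy_def intro: has_bochner_integral_integrable\<close>)
    have Wint: "integrable lborel (wsq \<nu> (W j))" for j
    proof (rule Bochner_Integration.integrable_bound)
      show "integrable lborel (\<lambda>s. 2 * wsq \<nu> (g j) s + 2 * (q $ j)\<^sup>2 * wsq \<nu> (\<lambda>s. \<sigma> (s - d j)) s)"
        using Wb by (simp add: has_bochner_integral_iff)
      show "wsq \<nu> (W j) \<in> borel_measurable lborel"
        unfolding measurable_lborel2 by (intro wsq_measurable C1_line_continuous W1)
      show "AE s in lborel. norm (wsq \<nu> (W j) s)
          \<le> norm (2 * wsq \<nu> (g j) s + 2 * (q $ j)\<^sup>2 * wsq \<nu> (\<lambda>s. \<sigma> (s - d j)) s)"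
        using W_le[of j] wsq_nonneg[of \<nu> "W j"] by (intro AE_I2) (simp only: real_norm_def, smt (verit))
    qed
    have EW: "energy \<nu> (W j) \<le> (2 + 2 * (q $ j)\<^sup>2 * exp (2 * \<nu> * d j) * D) * G" for j
    proof -
      have "energy \<nu> (W j) \<le> 2 * energy \<nu> (g j) + 2 * (q $ j)\<^sup>2 * (exp (2 * \<nu> * d j) * energy \<nu> \<sigma>)"
        using integral_mono[OF Wint[of j] _ W_le[of j]] Wb[of j]
        by (simp add: energy_def has_bochner_integral_iff)
      also have "\<dots> \<le> 2 * G + 2 * (q $ j)\<^sup>2 * (exp (2 * \<nu> * d j) * (D * G))"
        by (intro add_mono mult_left_mono G0 E\<sigma>) auto
      finally show ?thesis by (simp add: algebra_simps)
    qed
    have phij: "integrable (lebesgue_on {0<..<L}) (\<lambda>x. (\<phi> 0 x $ j)\<^sup>2)"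
        "(LINT x|lebesgue_on {0<..<L}. (\<phi> 0 x $ j)\<^sup>2) \<le> exp (- 2 * \<nu> * T) * ((1 / \<mu> $ j) * energy \<nu> (W j))" for j
    proof -
      let ?h = "\<lambda>x. exp (- 2 * \<nu> * T) / (\<mu> $ j)\<^sup>2 * wsq \<nu> (W j) (T + (1 / \<mu> $ j) * x)"
      have hi: "integrable lborel ?h"
        using Wint \<mu>[of j] by (intro integrable_mult_right lborel_integrable_real_affine) auto
      have h0: "?h x \<ge> 0" for x by (simp add: wsq_nonneg)
      have hS: "integrable (lebesgue_on {0<..<L}) ?h"
        by (rule integral_lebesgue_on_le_lborel(1)[OF hi h0]) auto
      \<comment> \<open>At time \<open>0\<close> the arguments of \<open>W j\<close> are at least \<open>T\<close>, where the weight is at least \<open>exp (2 \<nu> T)\<close>.\<close>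
      have le: "(\<phi> 0 x $ j)\<^sup>2 \<le> ?h x" if "x \<in> {0<..<L}" for x
      proof -
        have "1 \<le> exp (- 2 * \<nu> * T) * exp (2 * \<nu> * (T + (1 / \<mu> $ j) * x))"
          using that \<nu> \<mu>[of j] by (simp add: algebra_simps flip: exp_add)
        then have "1 * ((W j (T + x / \<mu> $ j))\<^sup>2 / (\<mu> $ j)\<^sup>2)
            \<le> exp (- 2 * \<nu> * T) * exp (2 * \<nu> * (T + (1 / \<mu> $ j) * x)) * ((W j (T + x / \<mu> $ j))\<^sup>2 / (\<mu> $ j)\<^sup>2)"
          by (rule mult_right_mono) simp
        then show ?thesis by (simp add: \<phi>_def wsq_def power_divide mult_ac)
      qed
      have cm: "(\<lambda>x. (\<phi> 0 x $ j)\<^sup>2) \<in> borel_measurable (lebesgue_on {0<..<L})"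
        by (intro continuous_imp_measurable_on_sets_lebesgue continuous_intros
            continuous_on_subset[OF phic]) auto
      show i: "integrable (lebesgue_on {0<..<L}) (\<lambda>x. (\<phi> 0 x $ j)\<^sup>2)"
      proof (rule Bochner_Integration.integrable_bound[OF hS cm], rule AE_I2)
        fix x assume "x \<in> space (lebesgue_on {0<..<L})"
        then have "(\<phi> 0 x $ j)\<^sup>2 \<le> ?h x" by (intro le) simp
        also have "\<dots> \<le> norm (?h x)" unfolding real_norm_def by (rule abs_ge_self)
        finally show "norm ((\<phi> 0 x $ j)\<^sup>2) \<le> norm (?h x)" by simp
      qed
      have "(LINT x|lebesgue_on {0<..<L}. (\<phi> 0 x $ j)\<^sup>2) \<le> (LINT x|lebesgue_on {0<..<L}. ?h x)"
        using le by (intro integral_mono i hS) auto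
      also have "\<dots> \<le> (LINT x|lborel. ?h x)"
        by (rule integral_lebesgue_on_le_lborel(2)[OF hi h0]) auto
      also have "\<dots> = exp (- 2 * \<nu> * T) / (\<mu> $ j)\<^sup>2 * (LINT x|lborel. wsq \<nu> (W j) (T + (1 / \<mu> $ j) * x))"
        by simp
      also have "(LINT x|lborel. wsq \<nu> (W j) (T + (1 / \<mu> $ j) * x)) = \<mu> $ j * energy \<nu> (W j)"
        using lborel_integral_real_affine[of "1 / \<mu> $ j" "wsq \<nu> (W j)" T] \<mu>[of j]
        by (simp add: energy_def field_simps)
      finally show "(LINT x|lebesgue_on {0<..<L}. (\<phi> 0 x $ j)\<^sup>2) \<le> exp (- 2 * \<nu> * T) * ((1 / \<mu> $ j) * energy \<nu> (W j))"
        using \<mu>[of j] by (simp add: power2_eq_square)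
    qed
    have nrm: "(norm v)\<^sup>2 = (\<Sum>j\<in>UNIV. (v $ j)\<^sup>2)" for v :: "real^'n"
      by (simp add: norm_vec_def L2_set_def sum_nonneg)
    have psiL: "(LINT x|lebesgue_on {0<..<L}. (norm (\<psi> x))\<^sup>2) = \<Psi>"
    proof -
      have c: "(\<lambda>x. (norm (\<psi> x))\<^sup>2) \<in> borel_measurable borel"
        unfolding nrm by (intro borel_measurable_continuous_onI continuous_intros psic)
      have "(LINT x|lebesgue_on {0<..<L}. (norm (\<psi> x))\<^sup>2) = (LINT x|lborel. (norm (\<psi> x))\<^sup>2)"
        by (rule integral_lebesgue_on_eq_lborel[OF c]) (use psi0 in \<open>auto simp: nrm\<close>)
      also have "\<dots> = \<Psi>"
        unfolding nrm \<Psi>_def using psi_int by (intro Bochner_Integration.integral_sum) auto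
      finally show ?thesis .
    qed
    have bound: "(LINT x|lebesgue_on {0<..<L}. (norm (\<phi> 0 x))\<^sup>2)
         \<le> C * exp (- 2 * \<nu> * T) * (LINT x|lebesgue_on {0<..<L}. (norm (\<psi> x))\<^sup>2)"
    proof -
      have "(LINT x|lebesgue_on {0<..<L}. (norm (\<phi> 0 x))\<^sup>2)
          = (\<Sum>j\<in>UNIV. LINT x|lebesgue_on {0<..<L}. (\<phi> 0 x $ j)\<^sup>2)"
        unfolding nrm using phij(1) by (intro Bochner_Integration.integral_sum) auto
      also have "\<dots> \<le> (\<Sum>j\<in>UNIV. exp (- 2 * \<nu> * T) * ((1 / \<mu> $ j) * ((2 + 2 * (q $ j)\<^sup>2 * exp (2 * \<nu> * d j) * D) * G)))"
        using \<mu> by (intro sum_mono order_trans[OF phij(2)] mult_left_mono EW) (auto intro: less_imp_le)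
      also have "\<dots> = exp (- 2 * \<nu> * T) * (C1 * G)"
        by (simp only: C1_def sum_distrib_left sum_distrib_right mult_ac)
      also have "\<dots> \<le> exp (- 2 * \<nu> * T) * (C1 * (a * \<Psi>))"
        by (intro mult_left_mono G\<Psi> C1) auto
      also have "\<dots> \<le> exp (- 2 * \<nu> * T) * (C * \<Psi>)"
      proof -
        have "\<Psi> \<ge> 0" unfolding \<Psi>_def by (intro sum_nonneg) simp
        then show ?thesis by (intro mult_left_mono) (simp_all add: C_def algebra_simps)
      qed
      finally show ?thesis by (simp add: psiL mult_ac)
    qed
    show "\<exists>\<phi> \<phi>t \<phi>x. C1_rectangle T L \<phi> \<phi>t \<phi>x \<and>
       (\<forall>t\<in>{0..T}. diag \<mu> *v \<phi> t L = transpose (outer p q) *v (diag \<mu> *v \<phi> t 0)) \<and>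
       (\<forall>t x. \<phi>t t x + diag \<mu> *v \<phi>x t x = 0) \<and>
       (\<forall>x\<in>{0<..<L}. \<phi> T x = \<psi> x) \<and> continuous_on UNIV (\<phi> 0) \<and>
       (LINT x|lebesgue_on {0<..<L}. (norm (\<phi> 0 x))\<^sup>2)
         \<le> C * exp (- 2 * \<nu> * T) * (LINT x|lebesgue_on {0<..<L}. (norm (\<psi> x))\<^sup>2)"
      using rect bd pde final phic bound by blast
  qed
qed

text \<open>
  Duality: the pairing of a weak solution at time \<open>T\<close> with a test profile equals the pairing of the
  initial datum with the adjoint solution at time \<open>0\<close>, which is exponentially small. No
  representation or uniqueness of weak solutions is needed.
\<close>

lemma exponentially_stable_if_abs_sum_less_1:
  fixes \<mu> p q :: "real^'n::finite"
  assumes L: "L > 0" and \<mu>: "\<And>i. \<mu> $ i > 0"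
    and \<rho>: "(\<Sum>k\<in>UNIV. \<bar>p $ k * q $ k\<bar>) < 1"
  shows "exponentially_stable L (diag \<mu>) (outer p q)"
proof -
  let ?M = "lebesgue_on {0<..<L}"
  let ?g = "\<lambda>\<nu>. \<Sum>k\<in>UNIV. \<bar>p $ k * q $ k\<bar> * exp (2 * \<nu> * (L / \<mu> $ k))"
  have "(?g \<longlongrightarrow> ?g 0) (at_right 0)"
    by (intro tendsto_intros)
  then have "\<forall>\<^sub>F \<nu> in at_right 0. ?g \<nu> < 1"
    using \<rho> by (intro order_tendstoD) auto
  then have "\<forall>\<^sub>F \<nu> in at_right 0. ?g \<nu> < 1 \<and> \<nu> > 0"
    using eventually_at_right_less by (rule eventually_conj)
  then obtain \<nu> where \<nu>: "?g \<nu> < 1" "\<nu> > 0"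
    using eventually_happens[of _ "at_right (0::real)"] by auto
  obtain C where C: "C > 0" and adj: "\<And>\<psi> T. T > 0 \<Longrightarrow> (\<forall>j. test_fun L (\<lambda>x. \<psi> x $ j)) \<Longrightarrow>
    \<exists>\<phi> \<phi>t \<phi>x. C1_rectangle T L \<phi> \<phi>t \<phi>x \<and>
       (\<forall>t\<in>{0..T}. diag \<mu> *v \<phi> t L = transpose (outer p q) *v (diag \<mu> *v \<phi> t 0)) \<and>
       (\<forall>t x. \<phi>t t x + diag \<mu> *v \<phi>x t x = 0) \<and>
       (\<forall>x\<in>{0<..<L}. \<phi> T x = \<psi> x) \<and> continuous_on UNIV (\<phi> 0) \<and>
       (LINT x|?M. (norm (\<phi> 0 x))\<^sup>2)
         \<le> C * exp (- 2 * \<nu> * T) * (LINT x|?M. (norm (\<psi> x))\<^sup>2)"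
    using adjoint_solution[OF L \<mu> \<nu>(2) \<rho> \<nu>(1)] by blast
  define K where "K = max 1 (sqrt C)"
  have K: "K > 0" "K \<ge> 1" "K \<ge> sqrt C" by (auto simp: K_def)
  have "L2_norm L (R T) \<le> K * exp (- \<nu> * T) * L2_norm L R0"
    if R0: "R0 \<in> L2 L" and sol: "L2_solution L (diag \<mu>) (outer p q) R0 R" and T: "T \<ge> 0" for R0 R T
  proof (cases "T = 0")
    case True
    have RT: "R 0 \<in> L2 L" using sol by (simp add: L2_solution_def C0_L2_def)
    have "(LINT x|?M. (norm (R 0 x))\<^sup>2) = (LINT x|?M. (norm (R0 x))\<^sup>2)"
    proof (rule integral_cong_AE)
      show "AE x in ?M. (norm (R 0 x))\<^sup>2 = (norm (R0 x))\<^sup>2"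
        using sol unfolding L2_solution_def by auto
    qed (use RT R0 in \<open>auto simp: L2_def dest: borel_measurable_integrable\<close>)
    then have "L2_norm L (R 0) = 1 * L2_norm L R0" by (simp add: L2_norm_def)
    also have "\<dots> \<le> K * L2_norm L R0"
      using K by (intro mult_right_mono) (auto simp: L2_norm_def)
    finally show ?thesis using True by simp
  next
    case False
    then have T: "T > 0" using T by simp
    define B where "B = C * exp (- 2 * \<nu> * T)"
    have B: "B > 0" using C by (simp add: B_def)
    have RT: "R T \<in> L2 L" using sol T by (simp add: L2_solution_def C0_L2_def)
    have R0m: "R0 \<in> borel_measurable ?M" and R0i: "integrable ?M (\<lambda>x. (norm (R0 x))\<^sup>2)"
      using R0 by (auto simp: L2_def)
    have "(LINT x|?M. (norm (R T x))\<^sup>2) \<le> B * (LINT x|?M. (norm (R0 x))\<^sup>2)"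
    proof (rule L2_bound_by_testing[OF L RT])
      fix \<psi> :: "real \<Rightarrow> real^'n"
      assume "\<And>j. test_fun L (\<lambda>x. \<psi> x $ j)"
      then obtain \<phi> \<phi>t \<phi>x where \<phi>: "C1_rectangle T L \<phi> \<phi>t \<phi>x"
        "\<forall>t\<in>{0..T}. diag \<mu> *v \<phi> t L = transpose (outer p q) *v (diag \<mu> *v \<phi> t 0)"
        and pde: "\<And>t x. \<phi>t t x + diag \<mu> *v \<phi>x t x = 0"
        and final: "\<And>x. x \<in> {0<..<L} \<Longrightarrow> \<phi> T x = \<psi> x" and phic: "continuous_on UNIV (\<phi> 0)"
        and bound: "(LINT x|?M. (norm (\<phi> 0 x))\<^sup>2) \<le> B * (LINT x|?M. (norm (\<psi> x))\<^sup>2)"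
        using adj[OF T] unfolding B_def by blast
      have "(LINT x|?M. \<phi> T x \<bullet> R T x) - (LINT x|?M. \<phi> 0 x \<bullet> R0 x)
        = (LINT t|lebesgue_on {0..T}. LINT x|?M. (\<phi>t t x + diag \<mu> *v \<phi>x t x) \<bullet> R t x)"
        using sol T \<phi> unfolding L2_solution_def by blast
      then have "(LINT x|?M. \<phi> T x \<bullet> R T x) = (LINT x|?M. \<phi> 0 x \<bullet> R0 x)"
        by (simp add: pde)
      moreover have "(LINT x|?M. \<phi> T x \<bullet> R T x) = (LINT x|?M. \<psi> x \<bullet> R T x)"
        by (intro Bochner_Integration.integral_cong) (auto simp: final)
      ultimately have dual: "(LINT x|?M. \<psi> x \<bullet> R T x) = (LINT x|?M. \<phi> 0 x \<bullet> R0 x)" by simp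
      have phim: "\<phi> 0 \<in> borel_measurable ?M"
        by (intro continuous_imp_measurable_on_sets_lebesgue continuous_on_subset[OF phic]) auto
      have phii: "integrable ?M (\<lambda>x. (norm (\<phi> 0 x))\<^sup>2)"
        by (intro integral_open_interval_continuous(1) continuous_intros continuous_on_subset[OF phic]) auto
      \<comment> \<open>Young's inequality, weighted so that \<open>\<phi> 0\<close> contributes at most the square norm of \<open>\<psi>\<close>.\<close>
      have le: "\<bar>\<phi> 0 x \<bullet> R0 x\<bar> \<le> ((norm (\<phi> 0 x))\<^sup>2 / B + B * (norm (R0 x))\<^sup>2) / 2" for x
      proof -
        have "0 \<le> (norm (\<phi> 0 x) - B * norm (R0 x))\<^sup>2 / B" using B by simp
        also have "\<dots> = (norm (\<phi> 0 x))\<^sup>2 / B + B * (norm (R0 x))\<^sup>2 - 2 * (norm (\<phi> 0 x) * norm (R0 x))"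
          using B by (simp add: field_simps power2_eq_square)
        finally show ?thesis using Cauchy_Schwarz_ineq2[of "\<phi> 0 x" "R0 x"] by simp
      qed
      have hi: "integrable ?M (\<lambda>x. ((norm (\<phi> 0 x))\<^sup>2 / B + B * (norm (R0 x))\<^sup>2) / 2)"
        using phii R0i by auto
      have "integrable ?M (\<lambda>x. \<phi> 0 x \<bullet> R0 x)"
        by (rule Bochner_Integration.integrable_bound[OF hi])
           (use le phim R0m B in \<open>auto intro!: AE_I2 borel_measurable_inner simp del: divide_le_eq_numeral1\<close>)
      then have "(LINT x|?M. \<phi> 0 x \<bullet> R0 x) \<le> (LINT x|?M. ((norm (\<phi> 0 x))\<^sup>2 / B + B * (norm (R0 x))\<^sup>2) / 2)"
        by (intro integral_mono hi) (use le abs_le_D1 in blast)+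
      also have "\<dots> = ((LINT x|?M. (norm (\<phi> 0 x))\<^sup>2) / B + B * (LINT x|?M. (norm (R0 x))\<^sup>2)) / 2"
        using phii R0i by simp
      also have "\<dots> \<le> ((LINT x|?M. (norm (\<psi> x))\<^sup>2) + B * (LINT x|?M. (norm (R0 x))\<^sup>2)) / 2"
        using bound B by (simp add: divide_le_eq mult.commute)
      finally show "(LINT x|?M. \<psi> x \<bullet> R T x)
          \<le> ((LINT x|?M. (norm (\<psi> x))\<^sup>2) + B * (LINT x|?M. (norm (R0 x))\<^sup>2)) / 2"
        using dual by simp
    qed
    then have "L2_norm L (R T) \<le> sqrt B * L2_norm L R0"
      unfolding L2_norm_def real_sqrt_mult[symmetric] by (rule real_sqrt_le_mono)
    also have "sqrt B = sqrt C * exp (- \<nu> * T)"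
    proof -
      have "exp (- 2 * \<nu> * T) = (exp (- \<nu> * T))\<^sup>2"
        by (simp add: power2_eq_square flip: exp_add)
      then show ?thesis by (simp add: B_def real_sqrt_mult)
    qed
    also have "sqrt C * exp (- \<nu> * T) * L2_norm L R0 \<le> K * exp (- \<nu> * T) * L2_norm L R0"
      using K by (intro mult_right_mono) (auto simp: L2_norm_def)
    finally show ?thesis .
  qed
  then show ?thesis
    unfolding exponentially_stable_def using \<nu>(2) K(1) by blast
qed

section \<open>Classical solutions\<close>

text \<open>Bounded partial derivatives make \<open>\<phi>\<close> Lipschitz on the rectangle.\<close>

lemma C1_rectangle_continuous:
  fixes \<phi> :: "real \<Rightarrow> real \<Rightarrow> real^'n"
  assumes "C1_rectangle T L \<phi> \<phi>t \<phi>x"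
  shows "continuous_on ({0..T} \<times> {0..L}) (\<lambda>(t, x). \<phi> t x)"
proof -
  have dt: "\<And>t x. t \<in> {0..T} \<Longrightarrow> x \<in> {0..L} \<Longrightarrow> ((\<lambda>s. \<phi> s x) has_vector_derivative \<phi>t t x) (at t within {0..T})"
    and dx: "\<And>t x. t \<in> {0..T} \<Longrightarrow> x \<in> {0..L} \<Longrightarrow> ((\<lambda>y. \<phi> t y) has_vector_derivative \<phi>x t x) (at x within {0..L})"
    and ct: "continuous_on ({0..T} \<times> {0..L}) (\<lambda>(t, x). \<phi>t t x)"
    and cx: "continuous_on ({0..T} \<times> {0..L}) (\<lambda>(t, x). \<phi>x t x)"
    using assms unfolding C1_rectangle_def by blast+
  have bnd: "\<exists>B>0. \<forall>z\<in>{0..T} \<times> {0..L}. norm (f z) \<le> B"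
    if "continuous_on ({0..T} \<times> {0..L}) f" for f :: "real \<times> real \<Rightarrow> real^'n"
    using compact_imp_bounded[OF compact_continuous_image[OF that]]
    by (auto simp: compact_Times bounded_pos)
  obtain Bt Bx where Bt: "Bt > 0" "\<And>t x. t \<in> {0..T} \<Longrightarrow> x \<in> {0..L} \<Longrightarrow> norm (\<phi>t t x) \<le> Bt"
    and Bx: "Bx > 0" "\<And>t x. t \<in> {0..T} \<Longrightarrow> x \<in> {0..L} \<Longrightarrow> norm (\<phi>x t x) \<le> Bx"
    using bnd[OF ct] bnd[OF cx] by fastforce
  have on: "onorm (\<lambda>h. h *\<^sub>R v) \<le> norm v" for v :: "real^'n"
    by (rule onorm_le) (simp add: mult.commute)
  have "(Bt + Bx)-lipschitz_on ({0..T} \<times> {0..L}) (\<lambda>(t, x). \<phi> t x)"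
  proof (rule lipschitz_onI)
    fix z w :: "real \<times> real"
    assume zw: "z \<in> {0..T} \<times> {0..L}" "w \<in> {0..T} \<times> {0..L}"
    obtain t x s y where z: "z = (t, x)" and w: "w = (s, y)" by (cases z, cases w) auto
    have in_rect: "t \<in> {0..T}" "s \<in> {0..T}" "x \<in> {0..L}" "y \<in> {0..L}" using zw z w by auto
    have "norm (\<phi> t x - \<phi> s x) \<le> Bt * norm (t - s)"
      using in_rect dt Bt(2)
      by (intro differentiable_bound[of "{0..T}" "\<lambda>s. \<phi> s x" "\<lambda>t h. h *\<^sub>R \<phi>t t x"])
         (auto simp: has_vector_derivative_def intro: order_trans[OF on])
    moreover have "norm (\<phi> s x - \<phi> s y) \<le> Bx * norm (x - y)"
      using in_rect dx Bx(2)
      by (intro differentiable_bound[of "{0..L}" "\<lambda>y. \<phi> s y" "\<lambda>x h. h *\<^sub>R \<phi>x s x"])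
         (auto simp: has_vector_derivative_def intro: order_trans[OF on])
    moreover have "norm (t - s) \<le> dist z w" "norm (x - y) \<le> dist z w"
      using dist_fst_le[of z w] dist_snd_le[of z w] by (auto simp: z w dist_norm)
    then have "Bt * norm (t - s) \<le> Bt * dist z w" "Bx * norm (x - y) \<le> Bx * dist z w"
      using Bt(1) Bx(1) by (auto intro!: mult_left_mono)
    moreover have "norm (\<phi> t x - \<phi> s y) \<le> norm (\<phi> t x - \<phi> s x) + norm (\<phi> s x - \<phi> s y)"
      by (rule order_trans[OF _ norm_triangle_ineq]) simp
    ultimately show "dist ((\<lambda>(t, x). \<phi> t x) z) ((\<lambda>(t, x). \<phi> t x) w) \<le> (Bt + Bx) * dist z w"
      by (simp add: z w dist_norm[of "\<phi> t x"] distrib_right)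
  qed (use Bt Bx in simp)
  then show ?thesis by (rule lipschitz_on_continuous_on)
qed

text \<open>
  If \<open>h\<close> is a \<open>C\<^sup>1\<close> solution of the homogeneous delay equation on the whole line, then the waves
  \<open>p\<^sub>j h(t - x/\<mu>\<^sub>j)\<close> form a classical solution; integration by parts makes it a weak one.
\<close>

lemma L2_solution_of_delay_solution:
  fixes \<mu> p q :: "real^'n::finite"
  assumes L: "L > 0" and \<mu>: "\<And>i. \<mu> $ i > 0"
    and h': "continuous_on UNIV h'" "\<And>s. (h has_real_derivative h' s) (at s)"
    and delay: "\<And>t. h t = (\<Sum>j\<in>UNIV. p $ j * q $ j * h (t - L / \<mu> $ j))"
  defines "R \<equiv> \<lambda>t x. \<chi> j. p $ j * h (t - x / \<mu> $ j)"
  shows "L2_solution L (diag \<mu>) (outer p q) (R 0) R"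
proof -
  define Rt where "Rt t x = (\<chi> j. p $ j * h' (t - x / \<mu> $ j))" for t x
  define Rx where "Rx t x = (\<chi> j. - (p $ j * h' (t - x / \<mu> $ j) / \<mu> $ j))" for t x
  have hc: "continuous_on UNIV h"
    using h'(2) by (meson DERIV_isCont continuous_at_imp_continuous_on)
  have Rc: "continuous_on S (\<lambda>(t, x). R t x)" for S
    unfolding R_def split_def divide_inverse
    by (intro continuous_intros continuous_on_compose2[OF hc]) auto
  have Rtc: "continuous_on S (\<lambda>(t, x). Rt t x)" for S
    unfolding Rt_def split_def divide_inverse
    by (intro continuous_intros continuous_on_compose2[OF h'(1)]) auto
  have Rc1: "continuous_on S (R t)" for S t
    unfolding R_def divide_inverse
    by (intro continuous_intros continuous_on_compose2[OF hc]) auto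
  have dRt: "((\<lambda>s. R s x) has_vector_derivative Rt t x) (at t within S)" for t x S
  proof (rule has_vector_derivative_vecI)
    fix j
    have "((\<lambda>s. p $ j * h (s - x / \<mu> $ j)) has_real_derivative p $ j * (h' (t - x / \<mu> $ j) * 1)) (at t within S)"
      by (intro DERIV_cmult DERIV_chain2[OF h'(2)]) (auto intro!: derivative_eq_intros)
    then show "((\<lambda>s. R s x $ j) has_real_derivative Rt t x $ j) (at t within S)"
      by (simp add: R_def Rt_def)
  qed
  have dRx: "((\<lambda>y. R t y) has_vector_derivative Rx t x) (at x within S)" for t x S
  proof (rule has_vector_derivative_vecI)
    fix j
    have "((\<lambda>y. p $ j * h (t - y / \<mu> $ j)) has_real_derivative p $ j * (h' (t - x / \<mu> $ j) * (- (1 / \<mu> $ j)))) (at x within S)"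
      by (intro DERIV_cmult DERIV_chain2[OF h'(2)])
         (use \<mu>[of j] in \<open>auto intro!: derivative_eq_intros\<close>)
    then show "((\<lambda>y. R t y $ j) has_real_derivative Rx t x $ j) (at x within S)"
      by (simp add: R_def Rx_def)
  qed
  have pde: "diag \<mu> *v Rx t x = - Rt t x" for t x
    using \<mu>[THEN less_imp_neq, THEN not_sym]
    by (simp add: vec_eq_iff diag_mult_nth Rt_def Rx_def)
  have bc: "R t 0 = outer p q *v R t L" for t
    using delay[of t] by (simp add: vec_eq_iff outer_mult_nth R_def mult_ac)
  have "C0_L2 L R"
    unfolding C0_L2_def
  proof (intro conjI allI impI)
    show "R t \<in> L2 L" for t by (intro L2_continuous Rc1)
    fix t :: real assume "t \<ge> 0"
    let ?F = "\<lambda>s. integral (cbox 0 L) (\<lambda>x. (norm (R s x - R t x))\<^sup>2)"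
    have "continuous_on {0..} ?F"
    proof (rule integral_continuous_on_param)
      have "continuous_on ({0..} \<times> cbox 0 L) (\<lambda>z. (norm ((\<lambda>(s, x). R s x) z - R t (snd z)))\<^sup>2)"
        by (intro continuous_intros Rc continuous_on_compose2[OF Rc1[of UNIV]]) auto
      then show "continuous_on ({0..} \<times> cbox 0 L) (\<lambda>(s, x). (norm (R s x - R t x))\<^sup>2)"
        by (simp add: split_def)
    qed
    then have "(?F \<longlongrightarrow> ?F t) (at t within {0..})"
      using \<open>t \<ge> 0\<close> unfolding continuous_on_def by blast
    then have "((\<lambda>s. sqrt (?F s)) \<longlongrightarrow> sqrt 0) (at t within {0..})"
      by (intro tendsto_intros) simp
    moreover have "L2_norm L (\<lambda>x. R s x - R t x) = sqrt (?F s)" for s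
    proof -
      have "continuous_on {0..L} (\<lambda>x. (norm (R s x - R t x))\<^sup>2)"
        by (intro continuous_intros Rc1)
      then show ?thesis
        by (simp add: L2_norm_def integral_open_interval_continuous(2))
    qed
    ultimately show "((\<lambda>s. L2_norm L (\<lambda>x. R s x - R t x)) \<longlongrightarrow> 0) (at t within {0..})"
      by simp
  qed
  moreover have "(LINT x|lebesgue_on {0<..<L}. \<phi> T x \<bullet> R T x) - (LINT x|lebesgue_on {0<..<L}. \<phi> 0 x \<bullet> R 0 x)
        = (LINT t|lebesgue_on {0..T}. LINT x|lebesgue_on {0<..<L}. (\<phi>t t x + diag \<mu> *v \<phi>x t x) \<bullet> R t x)"
    if T: "T > 0" and C1: "C1_rectangle T L \<phi> \<phi>t \<phi>x"
      and bd: "\<forall>t\<in>{0..T}. diag \<mu> *v \<phi> t L = transpose (outer p q) *v (diag \<mu> *v \<phi> t 0)" for T \<phi> \<phi>t \<phi>x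
  proof -
    have dt: "\<And>t x. t \<in> {0..T} \<Longrightarrow> x \<in> {0..L} \<Longrightarrow> ((\<lambda>s. \<phi> s x) has_vector_derivative \<phi>t t x) (at t within {0..T})"
      and dx: "\<And>t x. t \<in> {0..T} \<Longrightarrow> x \<in> {0..L} \<Longrightarrow> ((\<lambda>y. \<phi> t y) has_vector_derivative \<phi>x t x) (at x within {0..L})"
      and ct: "continuous_on ({0..T} \<times> {0..L}) (\<lambda>(t, x). \<phi>t t x)"
      and cx: "continuous_on ({0..T} \<times> {0..L}) (\<lambda>(t, x). \<phi>x t x)"
      using C1 unfolding C1_rectangle_def by blast+
    note c = C1_rectangle_continuous[OF C1]
    have slice: "continuous_on {0..L} (f t)" if "continuous_on ({0..T} \<times> {0..L}) (\<lambda>(t, x). f t x)" "t \<in> {0..T}"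
      for f :: "real \<Rightarrow> real \<Rightarrow> real^'n" and t
    proof -
      have 1: "continuous_on {0..L} (\<lambda>x. (t, x))" by (intro continuous_intros)
      have 2: "(\<lambda>x. (t, x)) ` {0..L} \<subseteq> {0..T} \<times> {0..L}" using that(2) by auto
      show ?thesis using continuous_on_compose2[OF that(1) 1 2] by simp
    qed
    define fx where "fx t x = \<phi> t x \<bullet> Rt t x + \<phi>t t x \<bullet> R t x" for t x
    have fxc: "continuous_on ({0..T} \<times> {0..L}) (\<lambda>(t, x). fx t x)"
      using continuous_on_add[OF continuous_on_inner[OF c Rtc] continuous_on_inner[OF ct Rc]]
      by (simp add: fx_def split_def)
    have fxc1: "continuous_on {0..L} (fx t)" if "t \<in> {0..T}" for t
    proof -
      have 1: "continuous_on {0..L} (\<lambda>x. (t, x))" by (intro continuous_intros)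
      have 2: "(\<lambda>x. (t, x)) ` {0..L} \<subseteq> {0..T} \<times> {0..L}" using that by auto
      show ?thesis using continuous_on_compose2[OF fxc 1 2] by simp
    qed
    \<comment> \<open>\<open>fx\<close> is the time derivative of \<open>\<phi> \<bullet> R\<close>.\<close>
    let ?F = "\<lambda>t. integral (cbox 0 L) (\<lambda>x. \<phi> t x \<bullet> R t x)"
    have "(?F has_vector_derivative integral (cbox 0 L) (fx t)) (at t within {0..T})" if t: "t \<in> {0..T}" for t
    proof (rule leibniz_rule_vector_derivative)
      show "((\<lambda>t. \<phi> t x \<bullet> R t x) has_vector_derivative fx t x) (at t within {0..T})"
        if "t \<in> {0..T}" "x \<in> cbox 0 L" for t x
        unfolding fx_def
        by (rule bounded_bilinear.has_vector_derivative[OF bounded_bilinear_inner])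
           (use that dt dRt in auto)
      show "(\<lambda>x. \<phi> t x \<bullet> R t x) integrable_on cbox 0 L" if "t \<in> {0..T}" for t
        using slice[OF c that] by (intro integrable_continuous continuous_intros Rc1) simp
    qed (use fxc t in auto)
    then have "((\<lambda>t. integral (cbox 0 L) (fx t)) has_integral (?F T - ?F 0)) {0..T}"
      using T by (intro fundamental_theorem_of_calculus) auto
    then have FTC: "integral {0..T} (\<lambda>t. integral {0..L} (fx t)) = ?F T - ?F 0"
      by (simp add: integral_unique)
    have F: "?F t = (LINT x|lebesgue_on {0<..<L}. \<phi> t x \<bullet> R t x)" if "t \<in> {0..T}" for t
      using slice[OF c that]
      by (subst integral_open_interval_continuous(2)) (auto intro!: continuous_intros Rc1)
    \<comment> \<open>The two integrands differ by the \<open>x\<close>-derivative of \<open>\<phi> \<bullet> (diag \<mu> *v R)\<close>, whose boundary terms cancel.\<close>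
    have inner: "(LINT x|lebesgue_on {0<..<L}. (\<phi>t t x + diag \<mu> *v \<phi>x t x) \<bullet> R t x) = integral {0..L} (fx t)"
      if t: "t \<in> {0..T}" for t
    proof -
      let ?B = "\<lambda>x. \<phi> t x \<bullet> (diag \<mu> *v R t x)"
      have "((\<lambda>x. \<phi> t x \<bullet> (diag \<mu> *v Rx t x) + \<phi>x t x \<bullet> (diag \<mu> *v R t x)) has_integral (?B L - ?B 0)) {0..L}"
      proof (rule fundamental_theorem_of_calculus)
        fix x assume "x \<in> {0..L}"
        then show "(?B has_vector_derivative (\<phi> t x \<bullet> (diag \<mu> *v Rx t x) + \<phi>x t x \<bullet> (diag \<mu> *v R t x))) (at x within {0..L})"
          by (intro bounded_bilinear.has_vector_derivative[OF bounded_bilinear_inner]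
              bounded_linear.has_vector_derivative[OF matrix_vector_mul_bounded_linear] dRx dx t)
      qed (use L in simp)
      moreover have "?B L - ?B 0 = 0"
      proof -
        have "?B L = (transpose (outer p q) *v (diag \<mu> *v \<phi> t 0)) \<bullet> R t L"
          using bd t by (simp add: inner_diag_commute[symmetric])
        also have "\<dots> = (diag \<mu> *v \<phi> t 0) \<bullet> (outer p q *v R t L)"
          by (simp add: dot_lmul_matrix[symmetric] vector_transpose_matrix inner_commute)
        also have "\<dots> = ?B 0" by (simp add: bc inner_diag_commute)
        finally show ?thesis by simp
      qed
      ultimately have b: "((\<lambda>x. \<phi>x t x \<bullet> (diag \<mu> *v R t x) - \<phi> t x \<bullet> Rt t x) has_integral 0) {0..L}"
        by (simp add: pde)
      have "(fx t has_integral integral {0..L} (fx t)) {0..L}"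
        using fxc1[OF t] by (intro integrable_integral integrable_continuous_real)
      from has_integral_add[OF this b]
      have "((\<lambda>x. (\<phi>t t x + diag \<mu> *v \<phi>x t x) \<bullet> R t x) has_integral integral {0..L} (fx t)) {0..L}"
        by (simp add: fx_def inner_add_left inner_diag_commute add.commute)
      moreover have "continuous_on {0..L} (\<lambda>x. (\<phi>t t x + diag \<mu> *v \<phi>x t x) \<bullet> R t x)"
        by (intro continuous_intros slice[OF ct t] slice[OF cx t] Rc1
            bounded_linear.continuous_on[OF matrix_vector_mul_bounded_linear])
      ultimately show ?thesis
        by (simp add: integral_open_interval_continuous(2) integral_unique)
    qed
    have ic: "continuous_on {0..T} (\<lambda>t. integral {0..L} (fx t))"
      using integral_continuous_on_param[of "{0..T}" 0 L fx] fxc by simp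
    have "(LINT t|lebesgue_on {0..T}. LINT x|lebesgue_on {0<..<L}. (\<phi>t t x + diag \<mu> *v \<phi>x t x) \<bullet> R t x)
        = (LINT t|lebesgue_on {0..T}. integral {0..L} (fx t))"
      by (intro Bochner_Integration.integral_cong) (auto simp: inner)
    also have "\<dots> = integral {0..T} (\<lambda>t. integral {0..L} (fx t))"
      by (intro lebesgue_integral_eq_integral continuous_imp_integrable_real ic) simp
    finally show ?thesis using FTC F T by simp
  qed
  ultimately show ?thesis
    unfolding L2_solution_def by blast
qed

section \<open>Resonant perturbations of the speeds\<close>

text \<open>
  The hypothesis \<open>delay\<close> says that \<open>h(s) = exp(a s) cos(\<omega> s)\<close> solves the delay equation. The
  solution built from it is multiplied by \<open>exp(2 \<pi> a/\<omega>) \<ge> 1\<close> over each period, so it does not decay.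
\<close>

lemma not_exponentially_stable_resonant:
  fixes \<mu> p q :: "real^'n::finite"
  assumes L: "L > 0" and \<mu>: "\<And>i. \<mu> $ i > 0" and a: "a \<ge> 0" and \<omega>: "\<omega> > 0"
    and delay: "\<And>t. (\<Sum>j\<in>UNIV. p $ j * q $ j * (exp (- a * (L / \<mu> $ j)) * cos (\<omega> * (t - L / \<mu> $ j)))) = cos (\<omega> * t)"
    and p: "p \<noteq> 0"
  shows "\<not> exponentially_stable L (diag \<mu>) (outer p q)"
proof
  assume "exponentially_stable L (diag \<mu>) (outer p q)"
  then obtain \<nu> C where \<nu>: "\<nu> > 0" and C: "C > 0"
    and decay: "\<And>R0 R t. R0 \<in> L2 L \<Longrightarrow> L2_solution L (diag \<mu>) (outer p q) R0 R \<Longrightarrow> t \<ge> 0 \<Longrightarrow>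
        L2_norm L (R t) \<le> C * exp (- \<nu> * t) * L2_norm L R0"
    unfolding exponentially_stable_def by blast
  define h where "h s = exp (a * s) * cos (\<omega> * s)" for s
  define h' where "h' s = a * exp (a * s) * cos (\<omega> * s) - exp (a * s) * (\<omega> * sin (\<omega> * s))" for s
  define R where "R = (\<lambda>t x. (\<chi> j. p $ j * h (t - x / \<mu> $ j)) :: real^'n)"
  have h'c: "continuous_on UNIV h'" unfolding h'_def by (intro continuous_intros)
  have hd: "(h has_real_derivative h' s) (at s)" for s
    unfolding h_def[abs_def] h'_def by (auto intro!: derivative_eq_intros simp: algebra_simps)
  have hdel: "h t = (\<Sum>j\<in>UNIV. p $ j * q $ j * h (t - L / \<mu> $ j))" for t
  proof -
    have "exp (a * (t - d)) = exp (a * t) * exp (- a * d)" for d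
      by (simp add: algebra_simps flip: exp_add)
    then have "(\<Sum>j\<in>UNIV. p $ j * q $ j * h (t - L / \<mu> $ j)) = exp (a * t) *
        (\<Sum>j\<in>UNIV. p $ j * q $ j * (exp (- a * (L / \<mu> $ j)) * cos (\<omega> * (t - L / \<mu> $ j))))"
      unfolding h_def sum_distrib_left by (intro sum.cong refl) (simp only: mult_ac)
    then show ?thesis by (simp only: delay h_def)
  qed
  have sol: "L2_solution L (diag \<mu>) (outer p q) (R 0) R"
    unfolding R_def by (rule L2_solution_of_delay_solution[OF L \<mu> h'c hd hdel])
  have hc: "continuous_on UNIV h" using hd by (meson DERIV_isCont continuous_at_imp_continuous_on)
  have Rc: "continuous_on S (R t)" for S t
    unfolding R_def divide_inverse by (intro continuous_intros continuous_on_compose2[OF hc]) auto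
  have RL: "R 0 \<in> L2 L" by (intro L2_continuous Rc)
  have pos: "L2_norm L (R 0) > 0"
  proof -
    obtain j where j: "p $ j \<noteq> 0" using p by (auto simp: vec_eq_iff)
    have c: "continuous_on {0..L} (\<lambda>x. (norm (R 0 x))\<^sup>2)" by (intro continuous_intros Rc)
    have "R 0 0 $ j \<noteq> 0" using j by (simp add: R_def h_def)
    then have "R 0 0 \<noteq> 0" by auto
    then have "integral {0..L} (\<lambda>x. (norm (R 0 x))\<^sup>2) \<noteq> 0"
      using integral_eq_0_iff[OF c _] L by fastforce
    moreover have "integral {0..L} (\<lambda>x. (norm (R 0 x))\<^sup>2) \<ge> 0"
      by (intro integral_nonneg integrable_continuous_real c) simp
    ultimately show ?thesis by (simp add: L2_norm_def integral_open_interval_continuous(2)[OF c])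
  qed
  define t where "t k = 2 * pi * real k / \<omega>" for k :: nat
  have t0: "t k \<ge> 0" for k using \<omega> by (simp add: t_def)
  have hper: "h (t k + s) = exp (a * t k) * h s" for k s
  proof -
    have "\<omega> * (t k + s) = \<omega> * s + 2 * pi * real k" using \<omega> by (simp add: t_def distrib_left)
    then have "cos (\<omega> * (t k + s)) = cos (\<omega> * s)"
      using cos_int_2pin[of "int k"] sin_int_2pin[of "int k"] by (simp add: cos_add)
    then show ?thesis by (simp add: h_def distrib_left exp_add)
  qed
  have "R (t k) = (\<lambda>x. exp (a * t k) *\<^sub>R R 0 x)" for k
    using hper[of k "- (x / _)" for x] by (auto simp: R_def vec_eq_iff fun_eq_iff)
  then have Rt: "L2_norm L (R (t k)) = exp (a * t k) * L2_norm L (R 0)" for k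
    by (simp add: L2_norm_def power_mult_distrib real_sqrt_mult)
  have ge1: "1 \<le> C * exp (- \<nu> * t k)" for k
  proof -
    have "1 * L2_norm L (R 0) \<le> exp (a * t k) * L2_norm L (R 0)"
      using a t0 pos by (intro mult_right_mono) auto
    also have "\<dots> \<le> C * exp (- \<nu> * t k) * L2_norm L (R 0)"
      using decay[OF RL sol t0] by (simp add: Rt)
    finally show ?thesis using pos by (simp add: mult_le_cancel_right)
  qed
  have "filterlim (\<lambda>k. real k * (2 * pi / \<omega>)) at_top sequentially"
    using \<omega> by (intro filterlim_at_top_mult_tendsto_pos[OF tendsto_const] filterlim_real_sequentially) auto
  then have "filterlim t at_top sequentially"
    by (simp add: t_def[abs_def] mult_ac)
  then have "(\<lambda>k. C * exp (- \<nu> * t k)) \<longlonglongrightarrow> C * 0"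
    by (intro tendsto_intros filterlim_compose[OF exp_at_bot]
         filterlim_tendsto_neg_mult_at_bot[OF tendsto_const]) (use \<nu> in auto)
  then have "1 \<le> C * 0"
    by (rule LIMSEQ_le_const) (use ge1 in auto)
  then show False by simp
qed

text \<open>
  The speed \<open>2 N/m\<close> with \<open>m = 2 \<lfloor>N/l\<rfloor> + e\<close> has the travel time \<open>m L/(2 N)\<close>, a multiple of \<open>L/(2 N)\<close> whose
  parity is that of \<open>e\<close>; such speeds approximate \<open>l\<close>.
\<close>

lemma rational_speeds_tendsto:
  fixes l :: real and e :: int
  assumes l: "l > 0" and e: "e \<in> {0, 1}"
  shows "(\<lambda>N. 2 * real N / of_int (2 * \<lfloor>real N / l\<rfloor> + e)) \<longlonglongrightarrow> l"
proof -
  let ?m = "\<lambda>N. 2 * \<lfloor>real N / l\<rfloor> + e"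
  have "(\<lambda>N. of_int (?m N) / (2 * real N) - 1 / l) \<longlonglongrightarrow> 0"
  proof (rule Lim_null_comparison)
    show "\<forall>\<^sub>F N in sequentially. norm (of_int (?m N) / (2 * real N) - 1 / l) \<le> 1 / real N"
    proof (rule eventually_sequentiallyI[of 1])
      fix N :: nat assume N: "1 \<le> N"
      have "\<bar>of_int (2 * \<lfloor>r\<rfloor> + e) - 2 * r\<bar> \<le> 2" for r :: real
        using e by (auto; linarith)
      then have "\<bar>of_int (?m N) - 2 * (real N / l)\<bar> \<le> 2" .
      then have "\<bar>of_int (?m N) - 2 * (real N / l)\<bar> / (2 * real N) \<le> 2 / (2 * real N)"
        by (rule divide_right_mono) simp
      moreover have "of_int (?m N) / (2 * real N) - 1 / l = (of_int (?m N) - 2 * (real N / l)) / (2 * real N)"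
        using N l by (simp add: field_simps)
      ultimately show "norm (of_int (?m N) / (2 * real N) - 1 / l) \<le> 1 / real N"
        by (simp add: abs_divide)
    qed
    show "(\<lambda>N. 1 / real N) \<longlonglongrightarrow> 0" by (rule lim_1_over_n)
  qed
  then have "(\<lambda>N. of_int (?m N) / (2 * real N)) \<longlonglongrightarrow> 1 / l"
    by (rule LIM_zero_cancel)
  then have "(\<lambda>N. inverse (of_int (?m N) / (2 * real N))) \<longlonglongrightarrow> inverse (1 / l)"
    using l by (intro tendsto_inverse) auto
  then show ?thesis by simp
qed

lemma cos_diff_parity:
  fixes k e :: int
  assumes "e \<in> {0, 1}"
  shows "cos (x - pi * of_int (2 * k + e)) = (if e = 0 then 1 else - 1) * cos x"
proof -
  have "x - pi * of_int (2 * k + e) = (x - pi * of_int e) - 2 * pi * of_int k"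
    by (simp add: algebra_simps)
  then have "cos (x - pi * of_int (2 * k + e)) = cos (x - pi * of_int e)"
    by (simp only: cos_diff[of "x - pi * of_int e"] cos_int_2pin sin_int_2pin mult_1_right mult_zero_right add_0_right)
  then show ?thesis using assms by (auto simp: cos_diff)
qed

text \<open>
  Arbitrarily small changes of the speeds bring all delayed oscillations in phase: at the frequency
  \<open>2 \<pi> N/L\<close>, the delay \<open>L/\<mu>\<^sub>j\<close> multiplies the cosine by the sign of \<open>p\<^sub>j q\<^sub>j\<close>, and the characteristic
  equation becomes \<open>\<Sum>\<^sub>j \<bar>p\<^sub>j q\<^sub>j\<bar> exp(-a L/\<mu>\<^sub>j) = 1\<close>. The left-hand side is at least \<open>1\<close> at \<open>a = 0\<close> and tends
  to \<open>0\<close>, so there is a root \<open>a \<ge> 0\<close>.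
\<close>

lemma not_robustly_exponentially_stable:
  fixes l p q :: "real^'n::finite"
  assumes L: "L > 0" and l: "\<And>i. l $ i > 0"
    and \<rho>: "(\<Sum>k\<in>UNIV. \<bar>p $ k * q $ k\<bar>) \<ge> 1"
  shows "\<not> robustly_exponentially_stable L l (outer p q)"
proof
  assume "robustly_exponentially_stable L l (outer p q)"
  then obtain \<epsilon> where \<epsilon>: "\<epsilon> > 0"
    and stable: "\<And>\<mu>. (\<forall>i. \<bar>\<mu> $ i - l $ i\<bar> \<le> \<epsilon>) \<Longrightarrow> exponentially_stable L (diag \<mu>) (outer p q)"
    unfolding robustly_exponentially_stable_def by blast
  define e :: "'n \<Rightarrow> int" where "e j = (if p $ j * q $ j \<ge> 0 then 0 else 1)" for j
  have e01: "e j \<in> {0, 1}" for j by (simp add: e_def)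
  define k where "k N j = \<lfloor>real N / l $ j\<rfloor>" for N :: nat and j
  have "\<forall>\<^sub>F N in sequentially. \<forall>j. \<bar>2 * real N / of_int (2 * k N j + e j) - l $ j\<bar> \<le> \<epsilon> \<and>
      2 * real N / of_int (2 * k N j + e j) > 0"
  proof (intro eventually_all_finite eventually_conj)
    fix j
    have lim: "(\<lambda>N. 2 * real N / of_int (2 * k N j + e j)) \<longlonglongrightarrow> l $ j"
      unfolding k_def by (rule rational_speeds_tendsto[OF l e01])
    show "\<forall>\<^sub>F N in sequentially. \<bar>2 * real N / of_int (2 * k N j + e j) - l $ j\<bar> \<le> \<epsilon>"
      using tendstoD[OF lim \<epsilon>] by eventually_elim (simp add: dist_norm)
    show "\<forall>\<^sub>F N in sequentially. 2 * real N / of_int (2 * k N j + e j) > 0"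
      by (rule order_tendstoD(1)[OF lim l])
  qed
  then obtain N :: nat where N: "\<And>j. \<bar>2 * real N / of_int (2 * k N j + e j) - l $ j\<bar> \<le> \<epsilon>"
      "\<And>j. 2 * real N / of_int (2 * k N j + e j) > 0"
    using eventually_happens'[OF sequentially_bot] by fast
  have N0: "N > 0" using N(2)[of undefined] by (cases "N = 0") auto
  define \<mu> :: "real^'n" where "\<mu> = (\<chi> j. 2 * real N / of_int (2 * k N j + e j))"
  have \<mu>: "\<mu> $ j > 0" "\<bar>\<mu> $ j - l $ j\<bar> \<le> \<epsilon>" for j using N by (simp_all add: \<mu>_def)
  define \<omega> where "\<omega> = 2 * pi * real N / L"
  have \<omega>: "\<omega> > 0" using N0 L by (simp add: \<omega>_def)
  have \<omega>d: "\<omega> * (L / \<mu> $ j) = pi * of_int (2 * k N j + e j)" for j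
    using N0 L by (simp add: \<omega>_def \<mu>_def del: of_int_add of_int_mult)
  have osc: "p $ j * q $ j * cos (\<omega> * (t - L / \<mu> $ j)) = \<bar>p $ j * q $ j\<bar> * cos (\<omega> * t)" for j t
    unfolding right_diff_distrib \<omega>d cos_diff_parity[OF e01] by (auto simp: e_def)
  let ?g = "\<lambda>a. \<Sum>j\<in>UNIV. \<bar>p $ j * q $ j\<bar> * exp (- a * (L / \<mu> $ j))"
  have "(?g \<longlongrightarrow> (\<Sum>j\<in>UNIV. \<bar>p $ j * q $ j\<bar> * 0)) at_top"
  proof (intro tendsto_sum tendsto_mult tendsto_const)
    fix j
    have "filterlim (\<lambda>a. - (L / \<mu> $ j) * a) at_bot at_top"
      using L \<mu>(1)[of j]
      by (intro filterlim_tendsto_neg_mult_at_bot[OF tendsto_const] filterlim_ident) auto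
    from filterlim_compose[OF exp_at_bot this]
    show "((\<lambda>a. exp (- a * (L / \<mu> $ j))) \<longlongrightarrow> 0) at_top" by (simp add: mult.commute)
  qed
  then have "\<forall>\<^sub>F a in at_top. ?g a < 1" by (intro order_tendstoD) auto
  then have "\<forall>\<^sub>F a in at_top. ?g a < 1 \<and> a \<ge> 0"
    using eventually_ge_at_top by (rule eventually_conj)
  then obtain b where b: "?g b < 1" "b \<ge> 0"
    using eventually_happens'[OF trivial_limit_at_top_linorder] by fast
  have "continuous_on {0..b} ?g" by (intro continuous_intros)
  then obtain a where a: "a \<ge> 0" "?g a = 1"
    using IVT2'[of ?g b 1 0] b \<rho> by auto
  have "p \<noteq> 0" using \<rho> by auto
  moreover have "(\<Sum>j\<in>UNIV. p $ j * q $ j * (exp (- a * (L / \<mu> $ j)) * cos (\<omega> * (t - L / \<mu> $ j)))) = cos (\<omega> * t)" for t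
  proof -
    have "p $ j * q $ j * (exp (- a * (L / \<mu> $ j)) * cos (\<omega> * (t - L / \<mu> $ j)))
        = \<bar>p $ j * q $ j\<bar> * exp (- a * (L / \<mu> $ j)) * cos (\<omega> * t)" for j
      using arg_cong[OF osc[of j t], of "\<lambda>z. exp (- a * (L / \<mu> $ j)) * z"] by (simp only: mult_ac)
    then show ?thesis by (simp only: sum_distrib_right[symmetric] a(2) mult_1_left)
  qed
  ultimately have "\<not> exponentially_stable L (diag \<mu>) (outer p q)"
    by (intro not_exponentially_stable_resonant[OF L \<mu>(1) a(1) \<omega>])
  then show False using stable[of \<mu>] \<mu>(2) by blast
qed

section \<open>The stability criterion\<close>

lemma robustly_exponentially_stable_outer_iff:
  fixes l p q :: "real^'n::finite"
  assumes L: "L > 0" and l: "\<And>i. l $ i > 0"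
  shows "robustly_exponentially_stable L l (outer p q) \<longleftrightarrow> (\<Sum>k\<in>UNIV. \<bar>p $ k * q $ k\<bar>) < 1"
proof
  assume "robustly_exponentially_stable L l (outer p q)"
  then show "(\<Sum>k\<in>UNIV. \<bar>p $ k * q $ k\<bar>) < 1"
    using not_robustly_exponentially_stable[OF L l] not_less by blast
next
  assume \<rho>: "(\<Sum>k\<in>UNIV. \<bar>p $ k * q $ k\<bar>) < 1"
  \<comment> \<open>Within half the smallest speed, all perturbed speeds stay positive.\<close>
  define m where "m = Min (range (($) l))"
  have m: "m > 0" "m \<le> l $ i" for i using l by (simp_all add: m_def)
  have "\<mu> $ i > 0" if "\<forall>i. \<bar>\<mu> $ i - l $ i\<bar> \<le> m / 2" for \<mu> :: "real^'n" and i
    using that[rule_format, of i] m(1) m(2)[of i] by linarith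
  then show "robustly_exponentially_stable L l (outer p q)"
    unfolding robustly_exponentially_stable_def
    using exponentially_stable_if_abs_sum_less_1[OF L _ \<rho>] m(1)
    by (intro exI[of _ "m / 2"]) auto
qed

theorem theorem3p3:
  fixes L :: real
    and M T A K0 KL :: "real^'n::{finite,linorder}^'n::{finite,linorder}"
    and l u v :: "real^'n::{finite,linorder}"
  assumes "L > 0"
    and "\<And>i. l $ i > 0"
    and "\<And>i j. i < j \<Longrightarrow> l $ j < l $ i"
    and "invertible T"
    and "matrix_inv T ** M ** T = diag l"
    and "invertible (A - K0)"
    and "KL = (columnvector u :: real^1^'n::{finite,linorder}) ** (rowvector v :: real^'n::{finite,linorder}^1)"
    and "u \<noteq> 0"
    and "v \<noteq> 0"
  shows "robustly_exponentially_stable L l (matrix_inv ((A - K0) ** T) ** KL ** T) \<longleftrightarrow>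
    (\<Sum>j\<in>UNIV. \<bar>(v v* T) $ j\<bar> * \<bar>(matrix_inv ((A - K0) ** T) *v u) $ j\<bar>) < 1"
  unfolding assms(7) rank_one_conjugation
    robustly_exponentially_stable_outer_iff[OF assms(1,2)]
  by (simp add: abs_mult mult.commute)

end
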